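(* Uniformly over $t\mid p-1$, as the prime $p\to\infty$, $$\sum_{\substack{1\le \lambda\le p-1\\ \mathrm{ord}\,\lambda=t}}J(p;\lambda)\lesssim t+p^{1/3}t^{1/2};$$ that is, for every $\varepsilon>0$ there exists a constant $c=c(\varepsilon)>0$ such that for every prime $p$ and every positive divisor $t$ of $p-1$, the sum on the left is less than $c\,(t+p^{1/3}t^{1/2})\,p^{\varepsilon}$.
   Context: $\mathbb{N}$ denotes the set of positive integers. For a prime $p$ and an integer $\lambda$, $J(p;\lambda)$ is the number of solutions of the congruence $x^{x}\equiv\lambda\pmod p$ with $x\in\mathbb{N}$, $x\le p-1$. For $\lambda$ coprime to $p$, $\mathrm{ord}\,\lambda$ is the multiplicative order of $\lambda$ modulo $p$, i.e. the smallest positive integer $t$ such that $\lambda^{t}\equiv1\pmod p$. The notation $A\lesssim B$ means $A<Bp^{o(1)}$; that is, for any $\varepsilon>0$ there exists $c=c(\varepsilon)>0$ such that $A<cBp^{\varepsilon}$. *)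

theory Defs
  imports "HOL-Number_Theory.Number_Theory" Complex_Main
begin

definition J :: "nat \<Rightarrow> int \<Rightarrow> nat" where
  "J p l = card {x::nat. 1 \<le> x \<and> x \<le> p - 1 \<and> [int x ^ x = l] (mod int p)}"

end

theory Submission
  imports Defs "HOL-Analysis.Convex" "HOL-Computational_Algebra.Polynomial"
begin

text \<open>
  If \<open>x\<^sup>x\<close> has order \<open>t\<close> and \<open>d = gcd x (ord x)\<close>, then \<open>ord x = t * d\<close> divides \<open>p - 1\<close>. So, up to the number
  of divisors \<open>d\<close> of \<open>p - 1\<close>, one has to count the \<open>y \<le> p / d\<close> in a fixed coset \<open>C\<close> of the subgroup
  of \<open>T\<close>-th roots of unity, \<open>T = t * d\<close>. For \<open>d \<ge> p\<^bsup>2/3\<^esup>\<close> the trivial bound \<open>p / d\<close> suffices, and for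
  \<open>p\<^bsup>1/3\<^esup> \<le> d \<le> p\<^bsup>2/3\<^esup>\<close> one counts products of two such \<open>y\<close>, each integer having few factorisations.

  For \<open>d < p\<^bsup>1/3\<^esup>\<close> a Fejer kernel of length \<open>K\<close> about \<open>d / 6\<close> bounds the count by \<open>O(t)\<close> plus the average
  of the exponential sums \<open>|S(a)|\<close> over \<open>C\<close> for \<open>0 < a < K\<close>. If \<open>t \<ge> p\<^bsup>1/3\<^esup>\<close>, then \<open>|S(a)| \<le> \<surd>p\<close> suffices.
  Otherwise \<open>T < p\<^bsup>2/3\<^esup>\<close>. Since \<open>S\<close> is constant on cosets, and a coset has at most
  \<open>T\<^bsup>1/3\<^esup> p\<^bsup>o(1)\<^esup>\<close> elements below \<open>K\<close> (the products of three of them are distinct modulo \<open>p\<close>, up to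
  divisor functions), the sum of \<open>|S(a)|\<^sup>4\<close> over \<open>a < K\<close> is controlled by the complete fourth moment. That is
  the additive energy of \<open>C\<close>, which is \<open>O(T\<^bsup>8/3\<^esup>)\<close> because, by Stepanov's method, every nonzero
  residue is a difference of elements of \<open>C\<close> in \<open>O(T\<^bsup>2/3\<^esup>)\<close> ways.
\<close>

section \<open>Integer polynomials modulo a prime\<close>

lemma synthetic_div_linear:
  fixes f :: "'a::comm_ring_1 poly"
  shows "f = [:poly f c:] + [:-c, 1:] * synthetic_div f c"
  using synthetic_div_correct'[of c f] by (simp add: algebra_simps)

text \<open>One derivative turns \<open>(X - y)^(n+1) h\<close> into \<open>(X - y)^n\<close> times
  a cofactor whose value at \<open>y\<close> is \<open>(n+1) h(y)\<close>; hence an induction over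
  all \<open>h\<close>.\<close>

lemma poly_pderiv_iter_linear_power:
  fixes h :: "int poly"
  shows "poly ((pderiv ^^ n) ([:-y, 1:] ^ n * h)) y = fact n * poly h y"
proof (induction n arbitrary: h)
  case 0
  then show ?case by simp
next
  case (Suc n)
  have "pderiv ([:-y, 1:] ^ Suc n * h)
      = [:-y, 1:] ^ n * (smult (of_nat (Suc n)) h + [:-y, 1:] * pderiv h)"
    by (simp add: pderiv_mult pderiv_power_Suc pderiv_pCons algebra_simps del: power_Suc)
       (simp add: algebra_simps)
  then have "poly ((pderiv ^^ Suc n) ([:-y, 1:] ^ Suc n * h)) y
      = fact n * poly (smult (of_nat (Suc n)) h + [:-y, 1:] * pderiv h) y"
    by (simp only: funpow_Suc_right o_apply Suc.IH)
  then show ?case by (simp add: algebra_simps)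
qed

lemma prime_not_dvd_fact:
  fixes p :: int
  assumes "prime p" "int n < p"
  shows "\<not> p dvd fact n"
proof
  assume "p dvd fact n"
  then have "int (nat p) dvd int (fact n)"
    using prime_gt_0_int[OF assms(1)] by simp
  then have "nat p dvd fact n" by (simp only: int_dvd_int_iff)
  moreover have "prime (nat p)" using assms(1) by simp
  ultimately have "nat p \<le> n" by (simp add: prime_dvd_fact_iff)
  then show False using assms(2) by simp
qed

text \<open>Factorisation over the field of residues, kept over the integers:
  \<open>smult p g\<close> collects what vanishes modulo \<open>p\<close>. Linear factors are split
  off one at a time. Once \<open>j\<close> of them are gone at \<open>y\<close>, the
  \<open>j\<close>-th derivative there is \<open>j! Q(y) h(y)\<close> modulo \<open>p\<close>; here
  \<open>j!\<close> is a unit as \<open>j < m \<le> p\<close>, and \<open>Q(y)\<close> is one as the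
  points are distinct modulo \<open>p\<close>, so \<open>h\<close> vanishes at
  \<open>y\<close>.\<close>

lemma high_order_zeros_factor:
  fixes f :: "int poly" and p :: int
  assumes p: "prime p" and fin: "finite S" and mp: "int m \<le> p"
    and dist: "\<And>x y. x \<in> S \<Longrightarrow> y \<in> S \<Longrightarrow> p dvd x - y \<Longrightarrow> x = y"
    and van: "\<And>y k. y \<in> S \<Longrightarrow> k < m \<Longrightarrow> p dvd poly ((pderiv ^^ k) f) y"
  shows "\<exists>g h. f = smult p g + (\<Prod>y\<in>S. [:-y, 1:] ^ m) * h"
  using fin dist van
proof (induction S rule: finite_induct)
  case empty
  show ?case by (intro exI[of _ 0] exI[of _ f]) simp
next
  case (insert y S)
  obtain g0 h0 where f0: "f = smult p g0 + (\<Prod>y\<in>S. [:-y, 1:] ^ m) * h0"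
    using insert.IH insert.prems by blast
  define Q where "Q = (\<Prod>y\<in>S. [:-y, 1:] ^ m)"
  have Qy: "\<not> p dvd poly Q y"
  proof
    assume "p dvd poly Q y"
    then have "p dvd (\<Prod>x\<in>S. (y - x) ^ m)" by (simp add: Q_def poly_prod)
    then obtain x where "x \<in> S" "p dvd (y - x) ^ m"
      using p insert.hyps(1) by (auto simp: prime_dvd_prod_iff)
    then have "p dvd y - x" using p prime_dvd_power by blast
    then show False using insert.prems(1)[of y x] \<open>x \<in> S\<close> insert.hyps(2) by auto
  qed
  have "j \<le> m \<Longrightarrow> \<exists>g h. f = smult p g + Q * [:-y, 1:] ^ j * h" for j
  proof (induction j)
    case 0
    then show ?case using f0 by (auto simp: Q_def)
  next
    case (Suc j)
    then obtain g h where gh: "f = smult p g + Q * [:-y, 1:] ^ j * h" by auto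
    have "p dvd poly ((pderiv ^^ j) f) y" using insert.prems(2) Suc.prems by simp
    moreover have "poly ((pderiv ^^ j) f) y
        = p * poly ((pderiv ^^ j) g) y + fact j * (poly Q y * poly h y)"
    proof -
      have "f = smult p g + [:-y, 1:] ^ j * (Q * h)" using gh by (simp add: algebra_simps)
      then have "(pderiv ^^ j) f
          = smult p ((pderiv ^^ j) g) + (pderiv ^^ j) ([:-y, 1:] ^ j * (Q * h))"
        by (simp only: higher_pderiv_add higher_pderiv_smult)
      then show ?thesis by (simp only: poly_add poly_smult poly_pderiv_iter_linear_power poly_mult)
    qed
    ultimately have "p dvd fact j * (poly Q y * poly h y)"
      by (metis dvd_add_right_iff dvd_triv_left)
    moreover have "\<not> p dvd fact j" using prime_not_dvd_fact[OF p] Suc.prems mp by simp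
    ultimately have "p dvd poly h y" using Qy p by (metis prime_dvd_mult_iff)
    then obtain c where c: "poly h y = p * c" by (auto simp: dvd_def)
    define h1 where "h1 = synthetic_div h y"
    have "h = smult p [:c:] + [:-y, 1:] * h1"
      using synthetic_div_linear[of h y] c by (simp add: h1_def)
    moreover have "smult p g + Q * X * (smult p C + L * h1) = smult p (g + Q * X * C) + Q * (L * X) * h1"
      for X C L by (simp add: algebra_simps smult_add_right)
    ultimately have "f = smult p (g + Q * [:-y, 1:] ^ j * [:c:]) + Q * [:-y, 1:] ^ Suc j * h1"
      by (simp only: gh power_Suc)
    then show ?case by blast
  qed
  from this[of m] show ?case
    using insert.hyps by (simp add: Q_def mult.commute)
qed

text \<open>Coefficients are replaced by their remainders, and a nonzero remainder is not a multiple
  of \<open>p\<close>. This makes the degree modulo \<open>p\<close> an ordinary degree.\<close>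

lemma poly_reduce_mod:
  fixes h :: "int poly" and p :: int
  shows "\<exists>h1 h2. h = smult p h1 + h2 \<and> (h2 = 0 \<or> \<not> p dvd lead_coeff h2)"
proof -
  define h2 where "h2 = map_poly (\<lambda>c. c mod p) h"
  have c2: "coeff h2 i = coeff h i mod p" for i by (simp add: h2_def coeff_map_poly)
  have "[:p:] dvd h - h2" by (simp add: const_poly_dvd_iff c2)
  then obtain h1 where "h - h2 = [:p:] * h1" by (auto simp: dvd_def)
  then have "h = smult p h1 + h2" by (simp add: algebra_simps)
  moreover have "h2 = 0 \<or> \<not> p dvd lead_coeff h2"
  proof (cases "h2 = 0")
    case False
    then have "lead_coeff h2 \<noteq> 0" by simp
    then show ?thesis by (metis c2 dvd_imp_mod_0 mod_mod_trivial)
  qed simp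
  ultimately show ?thesis by blast
qed

text \<open>The count of zeros with multiplicity over the field of residues; derivatives detect
  multiplicity reliably because \<open>m \<le> p\<close>.\<close>

lemma card_high_order_zeros:
  fixes f :: "int poly" and p :: int
  assumes p: "prime p" and fin: "finite S" and mp: "int m \<le> p"
    and dist: "\<And>x y. x \<in> S \<Longrightarrow> y \<in> S \<Longrightarrow> p dvd x - y \<Longrightarrow> x = y"
    and van: "\<And>y k. y \<in> S \<Longrightarrow> k < m \<Longrightarrow> p dvd poly ((pderiv ^^ k) f) y"
    and nz: "\<not> [:p:] dvd f"
  shows "m * card S \<le> Polynomial.degree f"
proof -
  define Q where "Q = (\<Prod>y\<in>S. [:-y, 1:] ^ m)"
  obtain g h where f: "f = smult p g + Q * h"
    using high_order_zeros_factor[OF p fin mp dist van] unfolding Q_def by blast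
  obtain h1 h2 where h: "h = smult p h1 + h2" and h2: "h2 = 0 \<or> \<not> p dvd lead_coeff h2"
    using poly_reduce_mod by blast
  have f': "f = smult p (g + Q * h1) + Q * h2"
    by (simp add: f h algebra_simps smult_add_right)
  have "h2 \<noteq> 0" using nz f' by (auto simp: dvd_def)
  have "Q \<noteq> 0" using fin by (simp add: Q_def)
  have degQ: "Polynomial.degree Q = m * card S" unfolding Q_def
    using fin by (subst degree_prod_eq_sum_degree) (auto simp: degree_power_eq)
  have lcQ: "lead_coeff Q = 1" unfolding Q_def by (simp add: lead_coeff_prod lead_coeff_power)
  \<comment> \<open>The leading term of \<open>Q * h2\<close> survives modulo \<open>p\<close>, as
    \<open>Q\<close> is monic and \<open>h2\<close> is reduced, so \<open>f\<close> has degree at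
    least \<open>n\<close>.\<close>
  define n where "n = Polynomial.degree (Q * h2)"
  have "coeff f n = p * coeff (g + Q * h1) n + lead_coeff h2"
    using lcQ by (subst f') (simp add: n_def lead_coeff_mult)
  then have "\<not> p dvd coeff f n" using h2 \<open>h2 \<noteq> 0\<close>
    by (metis dvd_add_right_iff dvd_triv_left)
  then have "n \<le> Polynomial.degree f" by (intro le_degree) auto
  moreover have "n = m * card S + Polynomial.degree h2"
    using \<open>Q \<noteq> 0\<close> \<open>h2 \<noteq> 0\<close> degQ by (simp add: n_def degree_mult_eq)
  ultimately show ?thesis by simp
qed

section \<open>Sparse polynomials and sparse linear systems modulo a prime\<close>

lemma smult_sum_right: "smult a (\<Sum>i\<in>S. f i) = (\<Sum>i\<in>S. smult a (f i))"
  by (induction S rule: infinite_finite_induct) (simp_all add: smult_add_right)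

text \<open>A polynomial with \<open>n\<close> nonzero coefficients cannot vanish to order \<open>n\<close> at \<open>h \<noteq> 0\<close>: the operator
  \<open>X d/dX - e0\<close> kills the term of exponent \<open>e0\<close>, multiplies the other coefficients by units (this needs
  exponents below \<open>p\<close>) and lowers the order by one.\<close>
lemma sparse_poly_order:
  fixes c :: "nat \<Rightarrow> int" and p h :: int
  assumes p: "prime p" and h: "\<not> p dvd h" and fin: "finite E"
    and E: "\<And>e. e \<in> E \<Longrightarrow> int e < p"
    and eq: "(\<Sum>e\<in>E. monom (c e) e) = smult p g + [:-h, 1:] ^ card E * R"
    and e: "e \<in> E"
  shows "p dvd c e"
  using fin E eq e
proof (induction E arbitrary: c g R e rule: finite_induct)
  case empty
  then show ?case by simp
next
  case (insert e0 E)
  define F where "F = (\<Sum>e\<in>insert e0 E. monom (c e) e)"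
  define n where "n = card E"
  have F: "F = smult p g + [:-h, 1:] ^ Suc n * R"
    using insert by (simp add: F_def n_def)
  define G where "G = monom 1 1 * pderiv F - smult (of_nat e0) F"
  have mono: "monom 1 1 * pderiv (monom a k) - smult (int e0) (monom a k)
      = monom ((int k - int e0) * a) k" for a k
    by (cases k) (auto simp: pderiv_monom mult_monom smult_monom diff_monom minus_monom algebra_simps)
  have "G = (\<Sum>e\<in>insert e0 E. monom ((int e - int e0) * c e) e)"
    unfolding G_def F_def higher_pderiv_sum[of 1, simplified] sum_distrib_left smult_sum_right
      sum_subtractf[symmetric] by (intro sum.cong refl mono)
  then have G1: "G = (\<Sum>e\<in>E. monom ((int e - int e0) * c e) e)"
    using insert.hyps by simp
  have dF: "pderiv F = smult p (pderiv g)
      + [:-h, 1:] ^ n * (smult (of_nat (Suc n)) R + [:-h, 1:] * pderiv R)"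
    by (simp add: F pderiv_add pderiv_smult pderiv_mult pderiv_power_Suc pderiv_pCons
        algebra_simps del: power_Suc) (simp add: algebra_simps)
  have G2: "G = smult p (monom 1 1 * pderiv g - smult (of_nat e0) g) + [:-h, 1:] ^ n *
      (monom 1 1 * (smult (of_nat (Suc n)) R + [:-h, 1:] * pderiv R)
        - smult (of_nat e0) ([:-h, 1:] * R))"
  proof -
    have "M * (smult p g' + P * Z) - smult a (smult p g + L * P * R)
        = smult p (M * g' - smult a g) + P * (M * Z - smult a (L * R))" for M g' P Z a L
      by (simp add: algebra_simps smult_diff_right smult_add_right)
    then show ?thesis unfolding G_def dF unfolding F power_Suc .
  qed
  have ihE: "p dvd c e" if "e \<in> E" for e
  proof -
    have "p dvd (int e - int e0) * c e"
      using insert.IH[OF _ G2[unfolded G1 n_def] that] insert.prems(1) by auto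
    moreover have "\<not> p dvd int e - int e0"
    proof
      assume "p dvd int e - int e0"
      moreover have "e \<noteq> e0" using that insert.hyps by auto
      ultimately have "p \<le> \<bar>int e - int e0\<bar>" by (intro zdvd_imp_le) auto
      then show False using insert.prems(1)[of e] insert.prems(1)[of e0] that by auto
    qed
    ultimately show ?thesis using p by (metis prime_dvd_mult_iff)
  qed
  \<comment> \<open>The term killed by the operator is recovered last: all other coefficients being
    multiples of \<open>p\<close>, evaluation at the unit \<open>h\<close> isolates
    \<open>c e0\<close>.\<close>
  have "p dvd c e0"
  proof -
    have "poly F h = p * poly g h" by (simp add: F)
    moreover have "poly F h = c e0 * h ^ e0 + (\<Sum>e\<in>E. c e * h ^ e)"
      using insert.hyps by (simp add: F_def poly_sum poly_monom)
    moreover have "p dvd (\<Sum>e\<in>E. c e * h ^ e)" using ihE by (intro dvd_sum) auto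
    ultimately have "p dvd c e0 * h ^ e0"
      by (metis dvd_add_left_iff dvd_triv_left)
    then show ?thesis using p h by (metis prime_dvd_mult_iff prime_dvd_power)
  qed
  then show ?case using ihE insert.prems by auto
qed

text \<open>Pigeonhole in place of linear algebra: the vectors with entries in
  \<open>{0..<p}\<close> outnumber their possible images, and the difference of two that collide is
  a solution.\<close>

lemma linear_system_mod_nontrivial:
  fixes M :: "'i \<Rightarrow> 'j \<Rightarrow> int" and p :: int
  assumes p: "p > 1" and fin: "finite I" "finite K" and card: "card K < card I"
  shows "\<exists>\<mu>. (\<exists>i\<in>I. \<not> p dvd \<mu> i) \<and> (\<forall>j\<in>K. p dvd (\<Sum>i\<in>I. \<mu> i * M i j))"
proof -
  define V where "V = PiE I (\<lambda>_. {0..<p})"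
  define W where "W = PiE K (\<lambda>_. {0..<p})"
  define \<Phi> where "\<Phi> v = restrict (\<lambda>j. (\<Sum>i\<in>I. v i * M i j) mod p) K" for v
  have cV: "card V = nat p ^ card I" unfolding V_def using fin by (simp add: card_PiE)
  have cW: "card W = nat p ^ card K" unfolding W_def using fin by (simp add: card_PiE)
  have finW: "finite W" unfolding W_def using fin by (intro finite_PiE) auto
  have "\<Phi> ` V \<subseteq> W" using p by (auto simp: \<Phi>_def W_def)
  moreover have "card W < card V" unfolding cV cW using p card by simp
  ultimately have "\<not> inj_on \<Phi> V" using finW by (meson card_inj_on_le not_le)
  then obtain u v where uv: "u \<in> V" "v \<in> V" "u \<noteq> v" "\<Phi> u = \<Phi> v"
    by (auto simp: inj_on_def)
  obtain i where i: "i \<in> I" "u i \<noteq> v i"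
    using uv(1-3) unfolding V_def by (metis PiE_ext)
  have "\<not> p dvd u i - v i"
  proof
    assume "p dvd u i - v i"
    then have "u i mod p = v i mod p" by (simp add: mod_eq_dvd_iff)
    moreover have "u i \<in> {0..<p}" "v i \<in> {0..<p}" using uv i by (auto simp: V_def)
    ultimately show False using i by simp
  qed
  moreover have "p dvd (\<Sum>i\<in>I. (u i - v i) * M i j)" if "j \<in> K" for j
  proof -
    have "(\<Sum>i\<in>I. u i * M i j) mod p = (\<Sum>i\<in>I. v i * M i j) mod p"
      using fun_cong[OF uv(4), of j] that by (simp add: \<Phi>_def)
    then show ?thesis
      by (simp add: mod_eq_dvd_iff left_diff_distrib sum_subtractf)
  qed
  ultimately show ?thesis using i by (intro exI[of _ "\<lambda>i. u i - v i"]) auto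
qed

section \<open>Stepanov's method\<close>

lemma mult_pderiv_power:
  fixes Z :: "int poly"
  shows "Z * pderiv (Z ^ k) = of_nat k * pderiv Z * Z ^ k"
proof (cases k)
  case (Suc n)
  show ?thesis unfolding Suc pderiv_power_Suc by (simp add: of_nat_poly mult_ac)
qed simp

text \<open>The polynomial \<open>r\<close> with \<open>w\<^sup>k f\<^bsup>(k)\<^esup> = r X\<^sup>u (X - h)\<^sup>v\<close>, where \<open>f = q X\<^sup>u (X - h)\<^sup>v\<close> and \<open>w = X (X - h)\<close>; its degree
  does not depend on the large exponents \<open>u\<close> and \<open>v\<close>.\<close>
primrec twisted_deriv :: "int \<Rightarrow> nat \<Rightarrow> nat \<Rightarrow> int poly \<Rightarrow> nat \<Rightarrow> int poly" where
  "twisted_deriv h u v q 0 = q"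
| "twisted_deriv h u v q (Suc k) =
     [:0, 1:] * [:-h, 1:] * pderiv (twisted_deriv h u v q k)
     + (of_nat u * [:-h, 1:] + of_nat v * [:0, 1:] - of_nat k * [:-h, 2:]) * twisted_deriv h u v q k"

lemma twisted_deriv_eq:
  "([:0, 1:] * [:-h, 1:]) ^ k * (pderiv ^^ k) (q * [:0, 1:] ^ u * [:-h, 1:] ^ v)
    = twisted_deriv h u v q k * [:0, 1:] ^ u * [:-h, 1:] ^ v"
proof (induction k)
  case 0
  then show ?case by simp
next
  case (Suc k)
  define X Y where "X = [:0, 1::int:]" and "Y = [:-h, 1:]"
  define f where "f = (pderiv ^^ k) (q * X ^ u * Y ^ v)"
  define t where "t = twisted_deriv h u v q k"
  have IH: "(X * Y) ^ k * f = t * X ^ u * Y ^ v"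
    using Suc.IH by (simp add: X_def Y_def f_def t_def)
  have dX: "X * pderiv (X ^ u) = of_nat u * X ^ u" and dY: "Y * pderiv (Y ^ v) = of_nat v * Y ^ v"
    using mult_pderiv_power[of X u] mult_pderiv_power[of Y v]
    by (simp_all add: X_def Y_def pderiv_pCons)
  have dW: "pderiv (X * Y) = [:-h, 2:]" by (simp add: X_def Y_def pderiv_pCons)
  \<comment> \<open>The product rule for \<open>(X * Y)^k f\<close>, solved for the term with
    \<open>pderiv f\<close>, so that the induction hypothesis applies inside the derivative.\<close>
  have "(X * Y) ^ Suc k * pderiv f = X * Y * pderiv ((X * Y) ^ k * f) - (X * Y) * pderiv ((X * Y) ^ k) * f"
    unfolding pderiv_mult[of "(X * Y) ^ k" f] by (simp only: power_Suc algebra_simps)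
  also have "\<dots> = X * Y * pderiv (t * X ^ u * Y ^ v) - of_nat k * [:-h, 2:] * (t * X ^ u * Y ^ v)"
    unfolding mult_pderiv_power dW using IH by (simp only: mult.assoc)
  also have "X * Y * pderiv (t * X ^ u * Y ^ v)
      = X * Y * pderiv t * X ^ u * Y ^ v + t * Y * (X * pderiv (X ^ u)) * Y ^ v
        + t * X ^ u * X * (Y * pderiv (Y ^ v))"
    by (simp add: pderiv_mult algebra_simps)
  also have "\<dots> - of_nat k * [:-h, 2:] * (t * X ^ u * Y ^ v)
      = (X * Y * pderiv t + (of_nat u * Y + of_nat v * X - of_nat k * [:-h, 2:]) * t) * X ^ u * Y ^ v"
    unfolding dX dY by (simp only: algebra_simps)
  finally show ?case by (simp add: f_def t_def X_def Y_def)
qed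

text \<open>Each step either differentiates and multiplies by a quadratic, or multiplies by a linear
  polynomial; both raise the degree by at most one.\<close>

lemma degree_twisted_deriv: "Polynomial.degree (twisted_deriv h u v q k) \<le> Polynomial.degree q + k"
proof (induction k)
  case 0
  then show ?case by simp
next
  case (Suc k)
  define t where "t = twisted_deriv h u v q k"
  \<comment> \<open>Constants need their own case: there the truncated \<open>degree t - 1\<close>
    would give the bound 2, which can be too large.\<close>
  have "Polynomial.degree ([:0, 1:] * [:-h, 1:] * pderiv t) \<le> Suc (Polynomial.degree q + k)"
  proof (cases "Polynomial.degree t = 0")
    case True
    then have "pderiv t = 0" by (simp add: pderiv_eq_0_iff)
    then show ?thesis by simp
  next
    case False
    have "Polynomial.degree ([:0, 1:] * [:-h, 1:] * pderiv t)
        \<le> Polynomial.degree ([:0, 1:] * [:-h, 1:]) + Polynomial.degree (pderiv t)"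
      by (rule degree_mult_le)
    also have "\<dots> \<le> 2 + (Polynomial.degree t - 1)" by (simp add: degree_pderiv)
    also have "\<dots> \<le> Suc (Polynomial.degree q + k)" using Suc.IH False by (simp add: t_def)
    finally show ?thesis .
  qed
  moreover have "Polynomial.degree
      ((of_nat u * [:-h, 1:] + of_nat v * [:0, 1:] - of_nat k * [:-h, 2:]) * t)
      \<le> Suc (Polynomial.degree q + k)"
  proof -
    have "of_nat u * [:-h, 1:] + of_nat v * [:0, 1:] - of_nat k * [:-h, 2:]
      = [:int k * h - int u * h, int u + int v - 2 * int k:]"
      by (simp add: of_nat_poly algebra_simps)
    then have "Polynomial.degree (of_nat u * [:-h, 1:] + of_nat v * [:0, 1:] - of_nat k * [:-h, 2:]) \<le> 1"
      by simp
    then show ?thesis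
      using degree_mult_le[of "of_nat u * [:-h, 1:] + of_nat v * [:0, 1:] - of_nat k * [:-h, 2:]" t]
        Suc.IH by (simp add: t_def)
  qed
  ultimately show ?case by (simp add: t_def degree_add_le)
qed

lemma poly_eq_sum_coeff:
  fixes f :: "'a::comm_semiring_1 poly"
  assumes "Polynomial.degree f < n"
  shows "poly f x = (\<Sum>j<n. coeff f j * x ^ j)"
  unfolding poly_altdef using assms
  by (intro sum.mono_neutral_left) (auto simp: coeff_eq_0)

text \<open>Independence modulo \<open>p\<close> of the building blocks of the auxiliary polynomial.
  Modulo \<open>p\<close>, the part with \<open>c = 0\<close> is divisible by
  \<open>(X - h)^T\<close> although it has at most \<open>T\<close> terms, so
  \<open>sparse_poly_order\<close> makes its coefficients vanish; the remaining sum is divided by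
  \<open>(X - h)^T\<close> and the argument repeats.\<close>

lemma sparse_sum_vanish:
  fixes \<mu> :: "nat \<Rightarrow> nat \<Rightarrow> int" and p h :: int
  assumes p: "prime p" and h: "\<not> p dvd h" and fin: "finite E"
    and E: "\<And>e. e \<in> E \<Longrightarrow> int e < p" and card: "card E \<le> T"
    and dvd: "[:p:] dvd (\<Sum>c<n. (\<Sum>e\<in>E. monom (\<mu> c e) e) * ([:-h, 1:] ^ T) ^ c)"
    and ce: "c < n" "e \<in> E"
  shows "p dvd \<mu> c e"
  using dvd ce
proof (induction n arbitrary: \<mu> c e)
  case 0
  then show ?case by simp
next
  case (Suc n)
  define Y where "Y = [:-h, 1:] ^ T"
  define F where "F c = (\<Sum>e\<in>E. monom (\<mu> c e) e)" for c
  define R where "R = (\<Sum>c<n. F (Suc c) * Y ^ c)"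
  have split: "(\<Sum>c<Suc n. F c * Y ^ c) = F 0 + Y * R"
    unfolding sum.lessThan_Suc_shift R_def sum_distrib_left by (simp add: algebra_simps)
  have "[:p:] dvd F 0 + Y * R" using Suc.prems(1) unfolding split[symmetric] unfolding F_def Y_def .
  then obtain g where g: "F 0 + Y * R = [:p:] * g" by (auto simp: dvd_def)
  have "Y = [:-h, 1:] ^ card E * [:-h, 1:] ^ (T - card E)"
    using card by (simp add: Y_def flip: power_add)
  then have "F 0 = smult p g + [:-h, 1:] ^ card E * (- ([:-h, 1:] ^ (T - card E) * R))"
    using g by (simp add: algebra_simps add_eq_0_iff2)
  then have zero: "p dvd \<mu> 0 e" if "e \<in> E" for e
    unfolding F_def using sparse_poly_order[OF p h fin E] that by blast
  have "[:p:] dvd F 0"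
    unfolding F_def by (intro dvd_sum) (auto simp: const_poly_dvd_iff zero)
  then have "[:p:] dvd Y * R" using \<open>[:p:] dvd F 0 + Y * R\<close> by (simp add: dvd_add_right_iff)
  \<comment> \<open>By Gauss's lemma the constant \<open>p\<close> is prime among integer
    polynomials, so the monic factor \<open>Y\<close> cancels.\<close>
  moreover have "prime_elem [:p:]" using p by (intro lift_prime_elem_poly prime_imp_prime_elem)
  moreover have "\<not> [:p:] dvd Y"
  proof
    assume "[:p:] dvd Y"
    then have "p dvd lead_coeff Y" unfolding const_poly_dvd_iff by blast
    moreover have "lead_coeff Y = 1" by (simp add: Y_def lead_coeff_power)
    ultimately show False using p not_prime_unit by metis
  qed
  ultimately have "[:p:] dvd R" using prime_elem_dvd_mult_iff by blast
  then have "p dvd \<mu> (Suc c) e" if "c < n" "e \<in> E" for c e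
    using Suc.IH[of "\<lambda>c. \<mu> (Suc c)"] that by (simp add: R_def F_def Y_def)
  then show ?case using zero Suc.prems(2,3) by (cases c) auto
qed

text \<open>The auxiliary polynomial is a combination of the \<open>X\<^bsup>a + bT\<^esup> (X - h)\<^bsup>cT\<^esup>\<close> with \<open>a < A\<close> and \<open>b, c < B\<close>.
  At points of \<open>S\<close> the powers \<open>X\<^sup>T\<close> and \<open>(X - h)\<^sup>T\<close> become the constant \<open>\<gamma>\<close>, so vanishing to order \<open>m\<close> on all
  of \<open>S\<close> costs only \<open>m * (A + m)\<close> linear conditions.\<close>
theorem stepanov:
  fixes p h \<gamma> :: int
  assumes p: "prime p" and h: "\<not> p dvd h" and \<gamma>: "\<not> p dvd \<gamma>"
    and AB: "A * B \<le> T" and m: "m * (A + m) < A * B * B" "int m \<le> p" and BT: "int (2 * B * T) \<le> p"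
    and fin: "finite S"
    and dist: "\<And>x y. x \<in> S \<Longrightarrow> y \<in> S \<Longrightarrow> p dvd x - y \<Longrightarrow> x = y"
    and S: "\<And>y. y \<in> S \<Longrightarrow> [y ^ T = \<gamma>] (mod p)" "\<And>y. y \<in> S \<Longrightarrow> [(y - h) ^ T = \<gamma>] (mod p)"
  shows "m * card S \<le> 2 * B * T"
proof -
  define X Y where "X = [:0, 1::int:]" and "Y = [:-h, 1:]"
  have "A > 0" "B > 0" using m(1) by (auto intro: Nat.gr0I)
  have "A \<le> A * B" using \<open>B > 0\<close> by simp
  then have "A \<le> T" using AB by linarith
  \<comment> \<open>\<open>I\<close> indexes the unknown coefficients, \<open>K\<close> the
    conditions: an order \<open>k\<close> of differentiation and a coefficient index
    \<open>j\<close> of the twisted derivative.\<close>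
  define I where "I = {..<A} \<times> {..<B} \<times> {..<B}"
  define K where "K = {..<m} \<times> {..<A + m}"
  define D where "D k = (\<lambda>(a, b, c). twisted_deriv h (b * T) (c * T) (monom 1 a) k)" for k
  \<comment> \<open>The value modulo \<open>p\<close> that \<open>X^(b T) (X - h)^(c T)\<close>
    takes at every point of \<open>S\<close>.\<close>
  define \<gamma>' where "\<gamma>' = (\<lambda>(a::nat, b, c). \<gamma> ^ (b + c))"
  have "p > 1" using p by (simp add: prime_gt_1_int)
  have "\<exists>\<mu>. (\<exists>i\<in>I. \<not> p dvd \<mu> i) \<and> (\<forall>j\<in>K. p dvd (\<Sum>i\<in>I. \<mu> i * (\<lambda>i (k, j). \<gamma>' i * coeff (D k i) j) i j))"
    using \<open>p > 1\<close> m(1) by (intro linear_system_mod_nontrivial) (auto simp: I_def K_def algebra_simps)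
  then obtain \<mu> where \<mu>1: "\<exists>i\<in>I. \<not> p dvd \<mu> i"
    and \<mu>2: "\<And>k j. k < m \<Longrightarrow> j < A + m \<Longrightarrow> p dvd (\<Sum>i\<in>I. \<mu> i * (\<gamma>' i * coeff (D k i) j))"
    by (fastforce simp: K_def)
  define g where "g = (\<lambda>(a, b, c). monom 1 a * X ^ (b * T) * Y ^ (c * T))"
  define \<Phi> where "\<Phi> = (\<Sum>i\<in>I. smult (\<mu> i) (g i))"
  have van: "p dvd poly ((pderiv ^^ k) \<Phi>) y" if y: "y \<in> S" and k: "k < m" for y k
  proof -
    have "(X * Y) ^ k * (pderiv ^^ k) \<Phi> = (\<Sum>i\<in>I. smult (\<mu> i) ((X * Y) ^ k * (pderiv ^^ k) (g i)))"
      by (simp add: \<Phi>_def higher_pderiv_sum higher_pderiv_smult sum_distrib_left)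
    also have "\<dots> = (\<Sum>i\<in>I. smult (\<mu> i) (D k i * (\<lambda>(a, b, c). X ^ (b * T) * Y ^ (c * T)) i))"
      unfolding g_def D_def X_def Y_def
      by (intro sum.cong refl arg_cong[of _ _ "smult _"])
         (simp only: case_prod_unfold twisted_deriv_eq mult.assoc[symmetric])
    finally have XYk: "(X * Y) ^ k * (pderiv ^^ k) \<Phi> = \<dots>" .
    have "poly X y * poly Y y = y * (y - h)" by (simp add: X_def Y_def)
    moreover have "poly (X ^ (b * T) * Y ^ (c * T)) y = (y ^ T) ^ b * ((y - h) ^ T) ^ c" for b c
      by (simp add: X_def Y_def mult.commute[of _ T] power_mult)
    ultimately have eq: "(y * (y - h)) ^ k * poly ((pderiv ^^ k) \<Phi>) y
        = (\<Sum>i\<in>I. \<mu> i * (poly (D k i) y * (\<lambda>(a, b, c). (y ^ T) ^ b * ((y - h) ^ T) ^ c) i))"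
      using arg_cong[OF XYk, of "\<lambda>f. poly f y"]
      by (simp only: poly_sum poly_smult poly_mult poly_power case_prod_unfold)
    have "[(y * (y - h)) ^ k * poly ((pderiv ^^ k) \<Phi>) y
        = (\<Sum>i\<in>I. \<mu> i * (poly (D k i) y * \<gamma>' i))] (mod p)"
      unfolding eq \<gamma>'_def power_add case_prod_unfold
      by (intro cong_sum cong_mult cong_pow cong_refl S y)
    \<comment> \<open>The polynomial evaluated here is zero modulo \<open>p\<close> coefficient by
      coefficient: its degree is at most \<open>a + k < A + m\<close>, and the conditions on
      \<open>\<mu>\<close> cover all these coefficients. The conditions are thus independent of
      \<open>y\<close>.\<close>
    moreover have "p dvd (\<Sum>i\<in>I. \<mu> i * (poly (D k i) y * \<gamma>' i))"
    proof -
      have "poly (D k i) y = (\<Sum>j<A + m. coeff (D k i) j * y ^ j)" if "i \<in> I" for i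
      proof (rule poly_eq_sum_coeff)
        obtain a b c where i: "i = (a, b, c)" by (cases i)
        have "Polynomial.degree (D k i) \<le> Polynomial.degree (monom (1::int) a) + k"
          unfolding D_def i by (simp add: degree_twisted_deriv)
        then show "Polynomial.degree (D k i) < A + m"
          using that k by (simp add: I_def i degree_monom_eq)
      qed
      then have "(\<Sum>i\<in>I. \<mu> i * (poly (D k i) y * \<gamma>' i))
          = (\<Sum>i\<in>I. \<Sum>j<A + m. \<mu> i * (\<gamma>' i * coeff (D k i) j) * y ^ j)"
        by (intro sum.cong refl) (simp add: sum_distrib_left sum_distrib_right algebra_simps)
      also have "\<dots> = (\<Sum>j<A + m. (\<Sum>i\<in>I. \<mu> i * (\<gamma>' i * coeff (D k i) j)) * y ^ j)"
        by (subst sum.swap) (simp add: sum_distrib_right)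
      also have "p dvd \<dots>" by (rule dvd_sum, rule dvd_mult2, rule \<mu>2) (use k in auto)
      finally show ?thesis .
    qed
    ultimately have "p dvd (y * (y - h)) ^ k * poly ((pderiv ^^ k) \<Phi>) y"
      by (simp add: cong_dvd_iff)
    \<comment> \<open>With \<open>T > 0\<close>, a factor \<open>p\<close> of \<open>y\<close> or
      \<open>y - h\<close> would pass to its \<open>T\<close>-th power and hence to
      \<open>\<gamma>\<close>; so \<open>(y (y - h))^k\<close> cancels.\<close>
    moreover have "T > 0" using \<open>A > 0\<close> \<open>A \<le> T\<close> by simp
    then have "\<not> p dvd y" "\<not> p dvd y - h"
      using S[OF y] \<gamma> by (metis cong_dvd_iff dvd_power dvd_trans)+
    ultimately show ?thesis using p by (metis prime_dvd_mult_iff prime_dvd_power)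
  qed
  define E where "E = (\<lambda>(a, b). a + b * T) ` ({..<A} \<times> {..<B})"
  have inj: "inj_on (\<lambda>(a, b). a + b * T) ({..<A} \<times> {..<B})"
  proof (intro inj_onI, clarsimp)
    fix a b a' b' assume *: "a < A" "a' < A" "a + b * T = a' + b' * T"
    then have "a < T" "a' < T" using \<open>A \<le> T\<close> by auto
    then have "(a + b * T) mod T = a" "(a' + b' * T) mod T = a'"
      "(a + b * T) div T = b" "(a' + b' * T) div T = b'" by auto
    then show "a = a' \<and> b = b'" using * by metis
  qed
  have E_less: "e < B * T" if eE: "e \<in> E" for e
  proof -
    obtain a b where e: "e = a + b * T" "a < A" "b < B" using eE by (auto simp: E_def)
    then have "e < (b + 1) * T" using \<open>A \<le> T\<close> by simp
    also have "\<dots> \<le> B * T" using e by (intro mult_right_mono) auto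
    finally show ?thesis .
  qed
  have nz: "\<not> [:p:] dvd \<Phi>"
  proof
    assume dv: "[:p:] dvd \<Phi>"
    \<comment> \<open>Since \<open>a < A \<le> T\<close>, division of the exponent
      \<open>e = a + b T\<close> by \<open>T\<close> recovers \<open>a\<close> and
      \<open>b\<close>.\<close>
    define \<nu> where "\<nu> c e = \<mu> (e mod T, e div T, c)" for c e
    have "\<Phi> = (\<Sum>c<B. \<Sum>(a, b)\<in>{..<A} \<times> {..<B}. smult (\<mu> (a, b, c)) (g (a, b, c)))"
      unfolding \<Phi>_def I_def sum.cartesian_product
      by (rule sum.reindex_bij_witness[of _ "\<lambda>(c, a, b). (a, b, c)" "\<lambda>(a, b, c). (c, a, b)"]) auto
    also have "\<dots> = (\<Sum>c<B. (\<Sum>e\<in>E. monom (\<nu> c e) e) * ([:-h, 1:] ^ T) ^ c)"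
    proof (intro sum.cong refl)
      fix c
      have X: "smult u (monom 1 a * X ^ k * Z) = monom u (a + k) * Z" for u a k Z
        by (simp add: X_def monom_altdef power_add)
      have Y: "([:-h, 1:] ^ T) ^ c = Y ^ (c * T)"
        by (simp add: Y_def mult.commute[of c] power_mult)
      have "(\<Sum>e\<in>E. monom (\<nu> c e) e)
          = (\<Sum>(a, b)\<in>{..<A} \<times> {..<B}. monom (\<nu> c (a + b * T)) (a + b * T))"
        unfolding E_def by (subst sum.reindex[OF inj]) (simp add: case_prod_unfold)
      also have "\<dots> * ([:-h, 1:] ^ T) ^ c
          = (\<Sum>(a, b)\<in>{..<A} \<times> {..<B}. smult (\<mu> (a, b, c)) (g (a, b, c)))"
        unfolding sum_distrib_right using \<open>A \<le> T\<close>
        by (intro sum.cong refl)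
           (auto simp: \<nu>_def g_def X Y)
      finally show "(\<Sum>(a, b)\<in>{..<A} \<times> {..<B}. smult (\<mu> (a, b, c)) (g (a, b, c)))
          = (\<Sum>e\<in>E. monom (\<nu> c e) e) * ([:-h, 1:] ^ T) ^ c" by simp
    qed
    finally have "[:p:] dvd (\<Sum>c<B. (\<Sum>e\<in>E. monom (\<nu> c e) e) * ([:-h, 1:] ^ T) ^ c)"
      using dv by simp
    moreover have "card E \<le> T" using AB inj by (simp add: E_def card_image)
    moreover have "int e < p" if "e \<in> E" for e
    proof -
      have "e < 2 * B * T" using E_less[OF that] by simp
      then show ?thesis using BT by linarith
    qed
    ultimately have "p dvd \<nu> c e" if "c < B" "e \<in> E" for c e
      using sparse_sum_vanish[OF p h, where E = E and T = T and n = B and \<mu> = \<nu>] that by (auto simp: E_def)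
    moreover obtain a b c where abc: "a < A" "b < B" "c < B" "\<not> p dvd \<mu> (a, b, c)"
      using \<mu>1 by (auto simp: I_def)
    moreover have "\<nu> c (a + b * T) = \<mu> (a, b, c)"
      using abc \<open>A \<le> T\<close> by (simp add: \<nu>_def)
    moreover have "a + b * T \<in> E" unfolding E_def using abc by (intro image_eqI[of _ _ "(a, b)"]) auto
    ultimately show False by metis
  qed
  have "Polynomial.degree \<Phi> \<le> 2 * B * T"
    unfolding \<Phi>_def
  proof (intro degree_sum_le)
    fix i assume "i \<in> I"
    then obtain a b c where i: "i = (a, b, c)" "a < A" "b < B" "c < B" by (auto simp: I_def)
    have "Polynomial.degree (smult (\<mu> i) (g i)) \<le> Polynomial.degree (g i)" by (rule degree_smult_le)
    also have "\<dots> \<le> a + b * T + c * T"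
      unfolding g_def i X_def Y_def prod.case
      by (intro order_trans[OF degree_mult_le] add_mono order_trans[OF degree_power_le])
         (simp_all add: degree_monom_eq)
    also have "a + b * T \<in> E" unfolding E_def using i by (intro image_eqI[of _ _ "(a, b)"]) auto
    then have "a + b * T < B * T" by (rule E_less)
    then have "a + b * T + c * T \<le> B * T + B * T" using i by (intro add_mono mult_right_mono) auto
    finally show "Polynomial.degree (smult (\<mu> i) (g i)) \<le> 2 * B * T" by simp
  qed (auto simp: I_def)
  then show ?thesis
    using card_high_order_zeros[OF p fin m(2) dist van nz] by (meson le_trans)
qed

section \<open>Power residue classes\<close>

text \<open>For prime \<open>p\<close> this is empty or a coset of the group of \<open>T\<close>-th
  roots of unity modulo \<open>p\<close>, given by its representatives between 0 and
  \<open>p\<close>.\<close>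

definition pow_res :: "int \<Rightarrow> nat \<Rightarrow> int \<Rightarrow> int set" where
  "pow_res p T \<gamma> = {y. 0 < y \<and> y < p \<and> [y ^ T = \<gamma>] (mod p)}"

lemma pow_res_subset: "pow_res p T \<gamma> \<subseteq> {0<..<p}"
  by (auto simp: pow_res_def)

lemma finite_pow_res [simp]: "finite (pow_res p T \<gamma>)"
  by (rule finite_subset[OF pow_res_subset]) simp

lemma residue_eqI:
  fixes x y p :: int
  assumes "x \<in> {0<..<p}" "y \<in> {0<..<p}" "p dvd x - y"
  shows "x = y"
proof -
  have "x mod p = y mod p" using assms(3) by (simp add: mod_eq_dvd_iff)
  then show ?thesis using assms(1,2) by simp
qed

lemma pow_res_not_dvd:
  assumes "prime p" "y \<in> pow_res p T \<gamma>"
  shows "\<not> p dvd y" "\<not> p dvd \<gamma>"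
proof -
  show y: "\<not> p dvd y" using assms(2) by (auto simp: pow_res_def dest: zdvd_imp_le)
  have "[y ^ T = \<gamma>] (mod p)" using assms(2) by (simp add: pow_res_def)
  then show "\<not> p dvd \<gamma>" using y assms(1) by (metis cong_dvd_iff prime_dvd_power)
qed

text \<open>The zero count with \<open>m = 1\<close> for the monic polynomial
  \<open>X^T - \<gamma>\<close>.\<close>

lemma card_pow_res:
  fixes p :: int
  assumes p: "prime p" and T: "T > 0"
  shows "card (pow_res p T \<gamma>) \<le> T"
proof -
  define f where "f = monom 1 T - [:\<gamma>:]"
  have deg: "Polynomial.degree f \<le> T"
    unfolding f_def by (intro degree_diff_le) (simp_all add: degree_monom_eq)
  have "coeff f T = 1" using T by (simp add: f_def coeff_pCons split: nat.splits)
  then have "\<not> [:p:] dvd f" using p not_prime_unit unfolding const_poly_dvd_iff by metis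
  moreover have "p dvd poly ((pderiv ^^ k) f) y" if "y \<in> pow_res p T \<gamma>" "k < 1" for y k
    using that by (simp add: f_def poly_monom pow_res_def cong_iff_dvd_diff)
  ultimately have "1 * card (pow_res p T \<gamma>) \<le> Polynomial.degree f"
    using prime_ge_1_int[OF p]
    by (intro card_high_order_zeros[OF p]) (auto intro: residue_eqI subsetD[OF pow_res_subset])
  then show ?thesis using deg by simp
qed

lemma cube_floor_exists:
  fixes T :: nat
  shows "\<exists>B. 8 * B ^ 3 \<le> T \<and> T < 8 * (B + 1) ^ 3"
proof -
  have "\<exists>B. \<not> T < 8 * B ^ 3 \<and> T < 8 * Suc B ^ 3"
  proof (rule ccontr)
    assume neg: "\<not> ?thesis"
    have "\<not> T < 8 * B ^ 3" for B by (induction B) (use neg in auto)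
    moreover have "T < 8 * Suc T ^ 3"
      using self_le_power[of "Suc T" 3] by simp
    ultimately show False by blast
  qed
  then show ?thesis by (auto simp: not_less)
qed

text \<open>Stepanov's bound \<open>2 B T / m\<close> with \<open>B\<close> near
  \<open>T^(1/3) / 2\<close>, \<open>A\<close> near \<open>T / B\<close> and \<open>m\<close> near
  \<open>B^2 / 2\<close>, which gives \<open>24 T^(2/3)\<close>. Cubing keeps the statement free of
  roots.\<close>

lemma card_pow_res_shift:
  fixes p :: int
  assumes p: "prime p" and T: "T > 0" and Tp: "int T ^ 3 \<le> p ^ 2" and h: "\<not> p dvd h"
  shows "card {y \<in> pow_res p T \<gamma>. [(y - h) ^ T = \<gamma>] (mod p)} ^ 3 \<le> 24 ^ 3 * T ^ 2"
proof -
  define S where "S = {y \<in> pow_res p T \<gamma>. [(y - h) ^ T = \<gamma>] (mod p)}"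
  \<comment> \<open>\<open>B\<close> is about half the cube root of \<open>T\<close>; the factor 8 makes the degree \<open>2 * B * T\<close> at most \<open>p\<close>.\<close>
  obtain B where B: "8 * B ^ 3 \<le> T" "T < 8 * (B + 1) ^ 3" using cube_floor_exists by blast
  have "S \<subseteq> pow_res p T \<gamma>" by (auto simp: S_def)
  then have "card S \<le> card (pow_res p T \<gamma>)" by (intro card_mono) auto
  then have ST: "card S \<le> T" using card_pow_res[OF p T, of \<gamma>] by linarith
  have "card S ^ 3 \<le> 24 ^ 3 * T ^ 2"
  proof (cases "B < 2 \<or> S = {}")
    case True
    then consider "S = {}" | "B = 0" | "B = 1" by linarith
    \<comment> \<open>For \<open>B < 2\<close> the parameters degenerate, but then
      \<open>T < 8 * 2^3\<close> and the trivial bound \<open>T\<close> is below the claim.\<close>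
    then have "S = {} \<or> T < 64" using B(2) by cases (auto simp: power3_eq_cube)
    then show ?thesis
    proof
      assume "T < 64"
      have "card S ^ 3 \<le> T ^ 3" using ST by (rule power_mono) simp
      also have "\<dots> = T * T ^ 2" by (simp add: power2_eq_square power3_eq_cube)
      also have "\<dots> \<le> 24 ^ 3 * T ^ 2" using \<open>T < 64\<close> by (intro mult_right_mono) auto
      finally show ?thesis .
    qed simp
  next
    case False
    define A where "A = T div B"
    \<comment> \<open>From \<open>m \<le> A\<close> follows \<open>m (A + m) \<le> 2 m A\<close>;
      subtracting 1 from \<open>B^2\<close> makes this strictly less than
      \<open>A B^2\<close>.\<close>
    define m where "m = (B ^ 2 - 1) div 2"
    have B2: "B \<ge> 2" using False by auto
    then have Bsq: "B ^ 2 \<ge> 4" using power_mono[of 2 B 2] by simp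
    have "A * B \<le> T" by (simp add: A_def)
    have "8 * B ^ 2 * B \<le> T" using B(1) by (simp add: power2_eq_square power3_eq_cube mult_ac)
    then have A: "8 * B ^ 2 \<le> A" unfolding A_def using B2 by (subst less_eq_div_iff_mult_less_eq) auto
    have m2: "2 * m \<le> B ^ 2 - 1" by (simp add: m_def)
    then have "m \<le> A" using A by linarith
    have "m * (A + m) \<le> (2 * m) * A" using mult_left_mono[OF \<open>m \<le> A\<close>, of m] by (simp add: algebra_simps)
    also have "\<dots> \<le> (B ^ 2 - 1) * A" using m2 by (intro mult_right_mono) auto
    also have "\<dots> < B ^ 2 * A" using A Bsq by (intro mult_strict_right_mono) auto
    finally have mA: "m * (A + m) < A * B * B" by (simp add: power2_eq_square mult_ac)
    have "B \<le> T" using B(1) self_le_power[of B 3] B2 by linarith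
    have "int (8 * B ^ 3) \<le> int T" using B(1) by (simp only: of_nat_le_iff)
    have BT: "int (2 * B * T) \<le> p"
    proof (rule ccontr)
      assume "\<not> ?thesis"
      \<comment> \<open>Ninth powers clear both cube roots:
        \<open>(2 B T)^9 \<le> T^12 \<le> p^8\<close>.\<close>
      then have "p ^ 9 < int (2 * B * T) ^ 9" using prime_gt_0_int[OF p] by (intro power_strict_mono) auto
      also have "\<dots> = (int (8 * B ^ 3)) ^ 3 * int T ^ 9" by (simp add: power_mult_distrib flip: power_mult)
      also have "\<dots> \<le> int T ^ 3 * int T ^ 9" using \<open>int (8 * B ^ 3) \<le> int T\<close>
        by (intro mult_right_mono power_mono) auto
      also have "\<dots> = (int T ^ 3) ^ 4" by (simp flip: power_mult power_add)
      also have "\<dots> \<le> (p ^ 2) ^ 4" using Tp by (intro power_mono) auto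
      also have "\<dots> = p ^ 8" by (simp flip: power_mult)
      also have "\<dots> \<le> p ^ 9" using prime_ge_1_int[OF p] by (intro power_increasing) auto
      finally show False by simp
    qed
    have "m \<le> B ^ 2" using m2 by linarith
    also have "\<dots> \<le> 2 * B * T" using \<open>B \<le> T\<close> by (simp add: power2_eq_square)
    finally have "int m \<le> p" using BT by linarith
    obtain y where "y \<in> pow_res p T \<gamma>" using False by (auto simp: S_def)
    then have \<gamma>: "\<not> p dvd \<gamma>" using pow_res_not_dvd p by blast
    have "m * card S \<le> 2 * B * T"
    proof (rule stepanov[OF p h \<gamma> \<open>A * B \<le> T\<close> mA \<open>int m \<le> p\<close> BT])
      show "finite S" by (simp add: S_def)
      show "x = y" if "x \<in> S" "y \<in> S" "p dvd x - y" for x y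
        using residue_eqI[of x p y] that subset_trans[OF \<open>S \<subseteq> _\<close> pow_res_subset] by blast
    qed (auto simp: S_def pow_res_def)
    \<comment> \<open>The floor and the subtracted 1 cost at most a factor 2: \<open>m\<close> is at
      least \<open>B^2 / 4\<close>.\<close>
    have "q \<le> 4 * ((q - 1) div 2)" if "q \<ge> 4" for q :: nat using that by linarith
    then have "B ^ 2 \<le> 4 * m" using Bsq unfolding m_def by blast
    then have "B ^ 2 * card S \<le> 4 * m * card S" by (rule mult_right_mono) simp
    also have "\<dots> \<le> 4 * (2 * B * T)" using \<open>m * card S \<le> 2 * B * T\<close> by simp
    finally have "B * (B * card S) \<le> B * (8 * T)" by (simp add: power2_eq_square mult_ac)
    then have "B * card S \<le> 8 * T" using B2 by simp
    then have "(B * card S) ^ 3 \<le> (8 * T) ^ 3" by (rule power_mono) simp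
    then have 1: "B ^ 3 * card S ^ 3 \<le> 512 * T ^ 3" by (simp add: power_mult_distrib)
    \<comment> \<open>\<open>B \<ge> 2\<close> turns the upper bound \<open>8 (B + 1)^3\<close> for
      \<open>T\<close> into \<open>27 B^3\<close>, so \<open>8 T / B\<close> is at most
      \<open>24 T^(2/3)\<close>.\<close>
    have "(2 * (B + 1)) ^ 3 \<le> (3 * B) ^ 3" using B2 by (intro power_mono) auto
    then have "8 * (B + 1) ^ 3 \<le> 27 * B ^ 3" by (simp only: power_mult_distrib) simp
    then have "T \<le> 27 * B ^ 3" using B(2) by linarith
    then have "T * card S ^ 3 \<le> 27 * (B ^ 3 * card S ^ 3)" by simp
    also have "\<dots> \<le> 27 * (512 * T ^ 3)" using 1 by simp
    also have "\<dots> = T * (24 ^ 3 * T ^ 2)" by (simp add: power2_eq_square power3_eq_cube)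
    finally show ?thesis using T by simp
  qed
  then show ?thesis by (simp add: S_def)
qed

section \<open>Exponential sums over power residue classes\<close>

definition ep :: "int \<Rightarrow> int \<Rightarrow> complex" where
  "ep p x = cis (2 * pi * real_of_int x / real_of_int p)"

lemma ep_add: "ep p (x + y) = ep p x * ep p y"
  by (simp add: ep_def cis_mult add_divide_distrib algebra_simps)

lemma ep_cnj: "cnj (ep p x) = ep p (- x)"
  by (simp add: ep_def cis_cnj)

lemma ep_0 [simp]: "ep p 0 = 1"
  by (simp add: ep_def)

lemma norm_ep [simp]: "cmod (ep p x) = 1"
  by (simp add: ep_def)

lemma ep_eq_1_iff:
  assumes "p > 0"
  shows "ep p x = 1 \<longleftrightarrow> p dvd x"
proof
  assume "p dvd x"
  then obtain k where "x = p * k" by (auto simp: dvd_def)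
  then have "2 * pi * real_of_int x / real_of_int p = 2 * pi * real_of_int k"
    using assms by simp
  then show "ep p x = 1" by (simp add: ep_def)
next
  assume "ep p x = 1"
  then have "cos (2 * pi * real_of_int x / real_of_int p) = 1"
    by (simp add: ep_def complex_eq_iff)
  then obtain n :: int where "2 * pi * real_of_int x / real_of_int p = real_of_int n * 2 * pi"
    by (auto simp: cos_one_2pi_int)
  then have "real_of_int x = real_of_int (p * n)" using assms by (simp add: field_simps)
  then show "p dvd x" by (simp only: of_int_eq_iff) simp
qed

lemma ep_cong:
  assumes "p > 0" "[x = y] (mod p)"
  shows "ep p x = ep p y"
proof -
  have "ep p x = ep p y * ep p (x - y)" by (simp flip: ep_add)
  moreover have "ep p (x - y) = 1" using assms by (simp add: ep_eq_1_iff cong_iff_dvd_diff)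
  ultimately show ?thesis by simp
qed

text \<open>Shifting the summation variable by one multiplies the sum by \<open>ep p k\<close>,
  which differs from 1 unless \<open>p\<close> divides \<open>k\<close>.\<close>

lemma sum_ep:
  assumes p: "p > 0"
  shows "(\<Sum>x\<in>{0..<p}. ep p (x * k)) = (if p dvd k then of_int p else 0)"
proof (cases "p dvd k")
  case True
  then have "ep p (x * k) = 1" for x using p by (simp add: ep_eq_1_iff)
  then show ?thesis using True p by simp
next
  case False
  define s where "s = (\<Sum>x\<in>{0..<p}. ep p (x * k))"
  have "s * ep p k = (\<Sum>x\<in>{0..<p}. ep p ((x + 1) * k))"
    by (simp add: s_def sum_distrib_right ep_add distrib_right)
  also have "\<dots> = (\<Sum>x\<in>{1..<p + 1}. ep p (x * k))"
    by (rule sum.reindex_bij_witness[of _ "\<lambda>x. x - 1" "\<lambda>x. x + 1"]) auto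
  also have "{1..<p + 1} = insert p {1..<p}" using p by auto
  also have "(\<Sum>x\<in>insert p {1..<p}. ep p (x * k)) = (\<Sum>x\<in>insert 0 {1..<p}. ep p (x * k))"
    using ep_eq_1_iff[OF p, of "p * k"] by simp
  also have "insert 0 {1..<p} = {0..<p}" using p by auto
  finally have "s * (ep p k - 1) = 0" by (simp add: s_def algebra_simps)
  then show ?thesis using False p by (simp add: ep_eq_1_iff s_def)
qed

text \<open>Parseval's identity. The map \<open>\<phi>\<close> is general so that the identity
  yields second moments, and the difference of a pair yields fourth moments.\<close>

lemma mean_square_exp_sum:
  fixes \<phi> :: "'a \<Rightarrow> int"
  assumes p: "p > 0" and fin: "finite Z"
  shows "(\<Sum>x\<in>{0..<p}. (cmod (\<Sum>z\<in>Z. ep p (x * \<phi> z)))\<^sup>2)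
    = of_int p * real (card {(z, z'). z \<in> Z \<and> z' \<in> Z \<and> p dvd \<phi> z - \<phi> z'})"
proof -
  have "complex_of_real ((cmod (\<Sum>z\<in>Z. ep p (x * \<phi> z)))\<^sup>2)
      = (\<Sum>(z, z')\<in>Z \<times> Z. ep p (x * (\<phi> z - \<phi> z')))" for x
  proof -
    have "complex_of_real ((cmod (\<Sum>z\<in>Z. ep p (x * \<phi> z)))\<^sup>2)
        = (\<Sum>z\<in>Z. ep p (x * \<phi> z)) * cnj (\<Sum>z\<in>Z. ep p (x * \<phi> z))"
      using complex_norm_square by simp
    also have "\<dots> = (\<Sum>z\<in>Z. \<Sum>z'\<in>Z. ep p (x * (\<phi> z - \<phi> z')))"
      by (simp add: sum_product ep_cnj right_diff_distrib flip: ep_add)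
    finally show ?thesis by (simp add: sum.cartesian_product)
  qed
  then have "complex_of_real (\<Sum>x\<in>{0..<p}. (cmod (\<Sum>z\<in>Z. ep p (x * \<phi> z)))\<^sup>2)
      = (\<Sum>x\<in>{0..<p}. \<Sum>(z, z')\<in>Z \<times> Z. ep p (x * (\<phi> z - \<phi> z')))"
    by simp
  also have "\<dots> = (\<Sum>(z, z')\<in>Z \<times> Z. \<Sum>x\<in>{0..<p}. ep p (x * (\<phi> z - \<phi> z')))"
    by (subst sum.swap) (simp add: case_prod_unfold)
  also have "\<dots> = (\<Sum>w\<in>Z \<times> Z. if p dvd \<phi> (fst w) - \<phi> (snd w) then of_int p else 0)"
    by (simp only: sum_ep[OF p] case_prod_unfold)
  also have "\<dots> = (\<Sum>w\<in>{w \<in> Z \<times> Z. p dvd \<phi> (fst w) - \<phi> (snd w)}. of_int p)"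
    using fin by (intro sum.inter_filter[symmetric]) auto
  also have "{w \<in> Z \<times> Z. p dvd \<phi> (fst w) - \<phi> (snd w)}
      = {(z, z'). z \<in> Z \<and> z' \<in> Z \<and> p dvd \<phi> z - \<phi> z'}" by auto
  finally have "complex_of_real (\<Sum>x\<in>{0..<p}. (cmod (\<Sum>z\<in>Z. ep p (x * \<phi> z)))\<^sup>2)
    = complex_of_real (of_int p * real (card {(z, z'). z \<in> Z \<and> z' \<in> Z \<and> p dvd \<phi> z - \<phi> z'}))"
    by (simp add: mult.commute)
  then show ?thesis by (simp only: of_real_eq_iff)
qed

definition exp_sum :: "int \<Rightarrow> int set \<Rightarrow> int \<Rightarrow> complex" where
  "exp_sum p C x = (\<Sum>y\<in>C. ep p (x * y))"

lemma norm_exp_sum_minus: "cmod (exp_sum p C (- x)) = cmod (exp_sum p C x)"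
proof -
  have "exp_sum p C (- x) = cnj (exp_sum p C x)" by (simp add: exp_sum_def ep_cnj)
  then show ?thesis by simp
qed

section \<open>Moments of exponential sums over cosets\<close>

lemma inverse_mod_exists:
  fixes p a :: int
  assumes "prime p" "\<not> p dvd a"
  shows "\<exists>b. [a * b = 1] (mod p)"
  using assms by (meson cong_solve_coprime_int coprime_commute prime_imp_coprime)

lemma inj_on_mult_mod:
  fixes p u :: int
  assumes p: "prime p" and u: "\<not> p dvd u"
  shows "inj_on (\<lambda>y. (u * y) mod p) {0<..<p}"
proof (rule inj_onI)
  fix x y assume xy: "x \<in> {0<..<p}" "y \<in> {0<..<p}" "(u * x) mod p = (u * y) mod p"
  then have "p dvd u * (x - y)" by (simp add: mod_eq_dvd_iff right_diff_distrib)
  then show "x = y" using p u residue_eqI[OF xy(1,2)] by (simp add: prime_dvd_mult_iff)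
qed

lemma mult_mod_in_pow_res:
  fixes p u :: int
  assumes p: "prime p" and u: "\<not> p dvd u" and y: "y \<in> pow_res p T \<gamma>"
    and eq: "[u ^ T * \<gamma> = \<delta>] (mod p)"
  shows "(u * y) mod p \<in> pow_res p T \<delta>"
proof -
  have p0: "p > 0" using p by (rule prime_gt_0_int)
  have "\<not> p dvd u * y" using p u pow_res_not_dvd(1)[OF p y] by (simp add: prime_dvd_mult_iff)
  then have "(u * y) mod p \<noteq> 0" by auto
  then have "(u * y) mod p > 0" using p0 by (simp add: order_less_le)
  moreover have "[((u * y) mod p) ^ T = \<delta>] (mod p)"
  proof -
    have "[((u * y) mod p) ^ T = (u * y) ^ T] (mod p)" by (intro cong_pow) simp
    also have "(u * y) ^ T = u ^ T * y ^ T" by (rule power_mult_distrib)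
    also have "[u ^ T * y ^ T = u ^ T * \<gamma>] (mod p)"
      using y by (intro cong_mult cong_refl) (simp add: pow_res_def)
    finally show ?thesis using eq cong_trans by blast
  qed
  ultimately show ?thesis using p0 by (simp add: pow_res_def)
qed

text \<open>The quotient \<open>g = x / a\<close> is a \<open>T\<close>-th root of unity modulo
  \<open>p\<close>, so multiplication by it permutes the coset.\<close>

lemma exp_sum_pow_res_invariant:
  fixes p :: int
  assumes p: "prime p" and x: "\<not> p dvd x" and a: "\<not> p dvd a" and eq: "[x ^ T = a ^ T] (mod p)"
  shows "exp_sum p (pow_res p T \<gamma>) x = exp_sum p (pow_res p T \<gamma>) a"
proof -
  have p0: "p > 0" using p by (rule prime_gt_0_int)
  obtain b where b: "[a * b = 1] (mod p)" using inverse_mod_exists[OF p a] by blast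
  define g where "g = x * b"
  define C where "C = pow_res p T \<gamma>"
  have "[a * g = (a * b) * x] (mod p)" by (simp add: g_def algebra_simps)
  also have "[(a * b) * x = 1 * x] (mod p)" using b by (intro cong_mult) auto
  finally have ag: "[a * g = x] (mod p)" by simp
  have "[g ^ T = a ^ T * b ^ T] (mod p)"
    unfolding g_def power_mult_distrib using eq by (intro cong_mult) auto
  also have "a ^ T * b ^ T = (a * b) ^ T" by (simp add: power_mult_distrib)
  also have "[(a * b) ^ T = 1 ^ T] (mod p)" using b by (rule cong_pow)
  finally have gT: "[g ^ T = 1] (mod p)" by simp
  have g: "\<not> p dvd g" using ag x by (metis cong_dvd_iff dvd_mult)
  have "inj_on (\<lambda>y. (g * y) mod p) C"
    using inj_on_mult_mod[OF p g] pow_res_subset unfolding C_def by (rule inj_on_subset)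
  moreover have "(\<lambda>y. (g * y) mod p) ` C \<subseteq> C"
    using mult_mod_in_pow_res[OF p g] cong_mult[OF gT cong_refl[of \<gamma>]] by (auto simp: C_def)
  ultimately have bij: "bij_betw (\<lambda>y. (g * y) mod p) C C"
    unfolding bij_betw_def C_def by (simp add: endo_inj_surj)
  have "exp_sum p C x = (\<Sum>y\<in>C. ep p (a * ((g * y) mod p)))"
    unfolding exp_sum_def
  proof (intro sum.cong refl ep_cong[OF p0])
    fix y
    have "[a * ((g * y) mod p) = a * (g * y)] (mod p)" by (intro cong_mult cong_refl) simp
    also have "a * (g * y) = (a * g) * y" by simp
    also have "[(a * g) * y = x * y] (mod p)" using ag by (intro cong_mult cong_refl)
    finally show "[x * y = a * ((g * y) mod p)] (mod p)" by (rule cong_sym)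
  qed
  also have "\<dots> = exp_sum p C a" unfolding exp_sum_def by (rule sum.reindex_bij_betw[OF bij])
  finally show ?thesis by (simp add: C_def)
qed

text \<open>For \<open>c\<close> in the left coset, multiplication by \<open>a / c\<close> carries
  it into the coset of \<open>a\<close>. Equality may fail, since the left side may be
  empty.\<close>

lemma card_pow_res_le:
  fixes p :: int
  assumes p: "prime p" and a: "\<not> p dvd a"
  shows "card (pow_res p T \<gamma>) \<le> card (pow_res p T (a ^ T))"
proof (cases "pow_res p T \<gamma> = {}")
  case False
  then obtain c where c: "c \<in> pow_res p T \<gamma>" by blast
  obtain b where b: "[c * b = 1] (mod p)"
    using inverse_mod_exists[OF p pow_res_not_dvd(1)[OF p c]] by blast
  have "\<not> p dvd b"
    using b p not_prime_unit by (metis cong_dvd_iff dvd_mult)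
  then have ab: "\<not> p dvd a * b" using p a by (simp add: prime_dvd_mult_iff)
  have "[(a * b) ^ T * \<gamma> = (a * b) ^ T * c ^ T] (mod p)"
    using c by (intro cong_mult cong_refl) (simp add: pow_res_def cong_sym)
  also have "(a * b) ^ T * c ^ T = a ^ T * (c * b) ^ T" by (simp add: power_mult_distrib)
  also have "[a ^ T * (c * b) ^ T = a ^ T * 1 ^ T] (mod p)"
    using b by (intro cong_mult cong_pow cong_refl)
  finally have eq: "[(a * b) ^ T * \<gamma> = a ^ T] (mod p)" by simp
  show ?thesis
  proof (rule card_inj_on_le)
    show "inj_on (\<lambda>y. (a * b * y) mod p) (pow_res p T \<gamma>)"
      using inj_on_mult_mod[OF p ab] pow_res_subset by (rule inj_on_subset)
  qed (use mult_mod_in_pow_res[OF p ab _ eq] in auto)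
qed simp

text \<open>Since \<open>f\<close> is constant on the coset of \<open>a\<close>, and this coset is
  at least as large as any other, \<open>card * f a\<close> is at most the sum of \<open>f\<close>
  over it. When \<open>a\<close> runs through \<open>I\<close>, each residue is met at most
  \<open>n\<close> times.\<close>

lemma averaging:
  fixes p :: int and f :: "int \<Rightarrow> real"
  assumes p: "prime p" and nonneg: "\<And>x. f x \<ge> 0"
    and inv: "\<And>x a. \<not> p dvd x \<Longrightarrow> \<not> p dvd a \<Longrightarrow> [x ^ T = a ^ T] (mod p) \<Longrightarrow> f x = f a"
    and I: "finite I" "\<And>a. a \<in> I \<Longrightarrow> \<not> p dvd a"
    and n: "\<And>\<delta>. real (card {a \<in> I. [a ^ T = \<delta>] (mod p)}) \<le> n"
  shows "real (card (pow_res p T \<gamma>)) * (\<Sum>a\<in>I. f a) \<le> n * (\<Sum>x\<in>{0..<p}. f x)"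
proof -
  have n0: "n \<ge> 0" using n[of 0] of_nat_0_le_iff order_trans by blast
  have "real (card (pow_res p T \<gamma>)) * f a \<le> (\<Sum>x\<in>{x \<in> {0<..<p}. [a ^ T = x ^ T] (mod p)}. f x)"
    if a: "a \<in> I" for a
  proof -
    have "real (card (pow_res p T \<gamma>)) * f a \<le> real (card (pow_res p T (a ^ T))) * f a"
      using card_pow_res_le[OF p I(2)[OF a], of T \<gamma>] nonneg by (intro mult_right_mono) auto
    also have "\<dots> = (\<Sum>x\<in>pow_res p T (a ^ T). f x)"
    proof -
      have "f x = f a" if "x \<in> pow_res p T (a ^ T)" for x
        using inv[OF pow_res_not_dvd(1)[OF p that] I(2)[OF a]] that by (simp add: pow_res_def)
      then show ?thesis by simp
    qed
    also have "pow_res p T (a ^ T) = {x \<in> {0<..<p}. [a ^ T = x ^ T] (mod p)}"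
      by (auto simp: pow_res_def cong_sym_eq)
    finally show ?thesis .
  qed
  then have "real (card (pow_res p T \<gamma>)) * (\<Sum>a\<in>I. f a)
      \<le> (\<Sum>a\<in>I. \<Sum>x\<in>{x \<in> {0<..<p}. [a ^ T = x ^ T] (mod p)}. f x)"
    unfolding sum_distrib_left by (rule sum_mono)
  also have "\<dots> = (\<Sum>x\<in>{0<..<p}. \<Sum>a\<in>{a \<in> I. [a ^ T = x ^ T] (mod p)}. f x)"
    using I(1) by (intro sum.swap_restrict) auto
  also have "\<dots> \<le> (\<Sum>x\<in>{0<..<p}. n * f x)"
    using n nonneg by (intro sum_mono) (simp add: mult_right_mono)
  also have "\<dots> \<le> n * (\<Sum>x\<in>{0..<p}. f x)"
    unfolding sum_distrib_left[symmetric] using n0 nonneg by (intro mult_left_mono sum_mono2) auto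
  finally show ?thesis .
qed

text \<open>\<open>averaging\<close> at the single point \<open>a\<close> with \<open>n = 1\<close>:
  the complete second moment is \<open>p * card C\<close>, and \<open>card C\<close>
  cancels.\<close>

lemma exp_sum_pow_res_sqrt:
  fixes p :: int
  assumes p: "prime p" and a: "\<not> p dvd a"
  shows "cmod (exp_sum p (pow_res p T \<gamma>) a) \<le> sqrt (of_int p)"
proof (cases "pow_res p T \<gamma> = {}")
  case True
  then show ?thesis using prime_gt_0_int[OF p] by (simp add: exp_sum_def)
next
  case False
  define C where "C = pow_res p T \<gamma>"
  have p0: "p > 0" using p by (rule prime_gt_0_int)
  have "real (card C) * (\<Sum>a\<in>{a}. (cmod (exp_sum p C a))\<^sup>2)
      \<le> 1 * (\<Sum>x\<in>{0..<p}. (cmod (exp_sum p C x))\<^sup>2)"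
    unfolding C_def
  proof (rule averaging[OF p])
    show "real (card {b \<in> {a}. [b ^ T = \<delta>] (mod p)}) \<le> 1" for \<delta>
    proof -
      have "card {b \<in> {a}. [b ^ T = \<delta>] (mod p)} \<le> card {a}" by (rule card_mono) auto
      then show ?thesis by simp
    qed
    show "(cmod (exp_sum p (pow_res p T \<gamma>) x))\<^sup>2 = (cmod (exp_sum p (pow_res p T \<gamma>) b))\<^sup>2"
      if "\<not> p dvd x" "\<not> p dvd b" "[x ^ T = b ^ T] (mod p)" for x b
      using exp_sum_pow_res_invariant[OF p that] by simp
  qed (use a in auto)
  also have "\<dots> = of_int p * real (card {(z, z'). z \<in> C \<and> z' \<in> C \<and> p dvd z - z'})"
    using mean_square_exp_sum[OF p0, of C "\<lambda>z. z"] by (simp add: exp_sum_def C_def)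
  also have "{(z, z'). z \<in> C \<and> z' \<in> C \<and> p dvd z - z'} = (\<lambda>z. (z, z)) ` C"
  proof -
    have "C \<subseteq> {0<..<p}" by (simp add: C_def pow_res_subset)
    then have "z = z'" if "z \<in> C" "z' \<in> C" "p dvd z - z'" for z z'
      using that by (intro residue_eqI[of z p z']) auto
    then show ?thesis by auto
  qed
  also have "card \<dots> = card C" by (intro card_image) (auto intro: inj_onI)
  finally have "real (card C) * (cmod (exp_sum p C a))\<^sup>2 \<le> real (card C) * of_int p"
    by (simp add: mult.commute)
  moreover have "card C > 0" using False by (simp add: C_def card_gt_0_iff)
  ultimately have "(cmod (exp_sum p C a))\<^sup>2 \<le> of_int p" by simp
  then show ?thesis unfolding C_def by (rule real_le_rsqrt)
qed

text \<open>A difference is represented at most \<open>card C\<close> times if it is zero and at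
  most \<open>R\<close> times otherwise, because its first entry fixes the second. Exactly
  \<open>card C\<close> of the pairs have difference zero.\<close>

lemma additive_energy_le:
  fixes C :: "int set"
  assumes fin: "finite C" and C: "C \<subseteq> {0<..<p}"
    and R: "\<And>h. \<not> p dvd h \<Longrightarrow> card {y \<in> C. \<exists>z\<in>C. p dvd y - z - h} \<le> R"
  shows "card {(z, z'). z \<in> C \<times> C \<and> z' \<in> C \<times> C \<and> p dvd (fst z - snd z) - (fst z' - snd z')}
    \<le> (card C)\<^sup>2 * (1 + R)"
proof -
  define N where "N z = {z' \<in> C \<times> C. p dvd (fst z - snd z) - (fst z' - snd z')}" for z :: "int \<times> int"
  have eqI: "x = y" if "x \<in> C" "y \<in> C" "p dvd x - y" for x y
    using that C by (intro residue_eqI[of x p y]) auto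
  have Nle: "card (N z) \<le> (if fst z = snd z then card C else R)" if z: "z \<in> C \<times> C" for z
  proof -
    define h where "h = fst z - snd z"
    have inj: "inj_on fst (N z)"
    proof (rule inj_onI)
      fix u v assume uv: "u \<in> N z" "v \<in> N z" "fst u = fst v"
      have "p dvd h - (fst u - snd u)" "p dvd h - (fst v - snd v)"
        using uv by (auto simp: N_def h_def)
      then have "p dvd (h - (fst u - snd u)) - (h - (fst v - snd v))" by (rule dvd_diff)
      then have "p dvd snd u - snd v" using uv(3) by simp
      then show "u = v" using eqI[of "snd u" "snd v"] uv by (auto simp: N_def prod_eq_iff)
    qed
    show ?thesis
    proof (cases "fst z = snd z")
      case True
      have "fst ` N z \<subseteq> C" by (auto simp: N_def)
      then show ?thesis using True card_inj_on_le[OF inj _ fin] by simp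
    next
      case False
      have h: "\<not> p dvd h" using False eqI z unfolding h_def by (metis mem_Times_iff)
      have "fst ` N z \<subseteq> {y \<in> C. \<exists>w\<in>C. p dvd y - w - h}"
      proof (rule image_subsetI)
        fix u assume u: "u \<in> N z"
        then have "p dvd - (h - (fst u - snd u))" unfolding N_def h_def by (subst dvd_minus_iff) auto
        then have "p dvd fst u - snd u - h" by simp
        then show "fst u \<in> {y \<in> C. \<exists>w\<in>C. p dvd y - w - h}" using u by (auto simp: N_def)
      qed
      then have "card (N z) \<le> card {y \<in> C. \<exists>w\<in>C. p dvd y - w - h}"
        using fin by (intro card_inj_on_le[OF inj]) auto
      then show ?thesis using False R[OF h] by simp
    qed
  qed
  have "{(z, z'). z \<in> C \<times> C \<and> z' \<in> C \<times> C \<and> p dvd (fst z - snd z) - (fst z' - snd z')}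
      = Sigma (C \<times> C) N" by (auto simp: N_def)
  then have "card {(z, z'). z \<in> C \<times> C \<and> z' \<in> C \<times> C \<and> p dvd (fst z - snd z) - (fst z' - snd z')}
      = (\<Sum>z\<in>C \<times> C. card (N z))" using fin by (simp add: N_def)
  also have "\<dots> \<le> (\<Sum>z\<in>C \<times> C. (if fst z = snd z then card C else 0) + R)"
  proof (rule sum_mono)
    fix z assume "z \<in> C \<times> C"
    from Nle[OF this] show "card (N z) \<le> (if fst z = snd z then card C else 0) + R"
      by (cases "fst z = snd z") simp_all
  qed
  also have "\<dots> = (\<Sum>z\<in>C \<times> C. if fst z = snd z then card C else 0) + (card C)\<^sup>2 * R"
    by (simp add: sum.distrib power2_eq_square card_cartesian_product)
  also have "(\<Sum>z\<in>C \<times> C. if fst z = snd z then card C else 0)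
      = (\<Sum>x\<in>C. \<Sum>y\<in>C. if x = y then card C else 0)"
    by (simp add: sum.cartesian_product case_prod_unfold)
  also have "\<dots> = (card C)\<^sup>2" using fin by (simp add: power2_eq_square)
  finally show ?thesis by (simp add: algebra_simps)
qed

text \<open>The square of \<open>|S|\<close> is the exponential sum over differences of pairs, so
  Parseval's identity turns the complete fourth moment into the additive energy;
  \<open>averaging\<close> passes from all residues to \<open>I\<close>.\<close>

lemma fourth_moment_pow_res:
  fixes p :: int
  assumes p: "prime p" and T: "T > 0" and I: "finite I" "\<And>a. a \<in> I \<Longrightarrow> \<not> p dvd a"
    and n: "\<And>\<delta>. real (card {a \<in> I. [a ^ T = \<delta>] (mod p)}) \<le> n"
    and R: "\<And>h. \<not> p dvd h \<Longrightarrow> card {y \<in> pow_res p T \<gamma>. [(y - h) ^ T = \<gamma>] (mod p)} \<le> R"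
  shows "(\<Sum>a\<in>I. cmod (exp_sum p (pow_res p T \<gamma>) a) ^ 4) \<le> n * of_int p * real T * (1 + real R)"
proof -
  define C where "C = pow_res p T \<gamma>"
  have p0: "p > 0" using p by (rule prime_gt_0_int)
  have n0: "n \<ge> 0" using n[of 0] of_nat_0_le_iff order_trans by blast
  show ?thesis
  proof (cases "C = {}")
    case True
    then show ?thesis using p0 n0 by (simp add: C_def exp_sum_def)
  next
    case False
    have sq: "cmod (exp_sum p C x) ^ 4 = (cmod (\<Sum>z\<in>C \<times> C. ep p (x * (fst z - snd z))))\<^sup>2" for x
    proof -
      have "exp_sum p C x * cnj (exp_sum p C x) = (\<Sum>z\<in>C. \<Sum>z'\<in>C. ep p (x * (z - z')))"
        by (simp add: exp_sum_def sum_product ep_cnj right_diff_distrib flip: ep_add)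
      also have "\<dots> = (\<Sum>z\<in>C \<times> C. ep p (x * (fst z - snd z)))"
        by (simp add: sum.cartesian_product case_prod_unfold)
      finally have "cmod (exp_sum p C x * cnj (exp_sum p C x))
          = cmod (\<Sum>z\<in>C \<times> C. ep p (x * (fst z - snd z)))" by simp
      then have "(cmod (exp_sum p C x))\<^sup>2 = cmod (\<Sum>z\<in>C \<times> C. ep p (x * (fst z - snd z)))"
        by (simp add: norm_mult power2_eq_square)
      moreover have "cmod (exp_sum p C x) ^ 4 = ((cmod (exp_sum p C x))\<^sup>2)\<^sup>2"
        by (simp flip: power_mult)
      ultimately show ?thesis by simp
    qed
    have "real (card C) * (\<Sum>a\<in>I. cmod (exp_sum p C a) ^ 4)
        \<le> n * (\<Sum>x\<in>{0..<p}. cmod (exp_sum p C x) ^ 4)"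
      unfolding C_def
    proof (rule averaging[OF p _ _ I n])
    show "cmod (exp_sum p (pow_res p T \<gamma>) x) ^ 4 = cmod (exp_sum p (pow_res p T \<gamma>) b) ^ 4"
      if "\<not> p dvd x" "\<not> p dvd b" "[x ^ T = b ^ T] (mod p)" for x b
      using exp_sum_pow_res_invariant[OF p that] by simp
    qed auto
    also have "\<dots> = n * (of_int p * real (card {(z, z'). z \<in> C \<times> C \<and> z' \<in> C \<times> C
        \<and> p dvd (fst z - snd z) - (fst z' - snd z')}))"
      unfolding sq by (subst mean_square_exp_sum[OF p0]) (simp_all add: C_def)
    \<comment> \<open>Of the two factors \<open>card C\<close>, one cancels against the left side
      and the other is at most \<open>T\<close>.\<close>
    also have "\<dots> \<le> n * (of_int p * real ((card C)\<^sup>2 * (1 + R)))"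
    proof (intro mult_left_mono n0 of_nat_mono)
      have sub: "{y \<in> C. \<exists>z\<in>C. p dvd y - z - h} \<subseteq> {y \<in> pow_res p T \<gamma>. [(y - h) ^ T = \<gamma>] (mod p)}" for h
      proof safe
        fix y z assume yz: "y \<in> C" "z \<in> C" "p dvd y - z - h"
        then show "y \<in> pow_res p T \<gamma>" by (simp add: C_def)
        have "p dvd (y - h) - z" using yz(3) by (simp add: algebra_simps)
        then have "[(y - h) ^ T = z ^ T] (mod p)" by (intro cong_pow) (simp add: cong_iff_dvd_diff)
        moreover have "[z ^ T = \<gamma>] (mod p)" using yz by (simp add: C_def pow_res_def)
        ultimately show "[(y - h) ^ T = \<gamma>] (mod p)" by (rule cong_trans)
      qed
      have "card {y \<in> C. \<exists>z\<in>C. p dvd y - z - h} \<le> R" if h: "\<not> p dvd h" for h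
        by (rule order_trans[OF card_mono[OF _ sub] R[OF h]]) simp
      then show "card {(z, z'). z \<in> C \<times> C \<and> z' \<in> C \<times> C \<and> p dvd (fst z - snd z) - (fst z' - snd z')}
          \<le> (card C)\<^sup>2 * (1 + R)"
        by (intro additive_energy_le) (auto simp: C_def pow_res_subset)
    qed (use p0 in auto)
    also have "\<dots> = real (card C) * (n * of_int p * real (card C) * (1 + real R))"
      by (simp add: power2_eq_square algebra_simps)
    finally have "(\<Sum>a\<in>I. cmod (exp_sum p C a) ^ 4) \<le> n * of_int p * real (card C) * (1 + real R)"
      using False by (simp add: C_def card_gt_0_iff)
    also have "\<dots> \<le> n * of_int p * real T * (1 + real R)"
      using card_pow_res[OF p T, of \<gamma>] n0 p0 by (intro mult_right_mono mult_left_mono) (auto simp: C_def)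
    finally show ?thesis by (simp add: C_def)
  qed
qed

text \<open>The factor 6 keeps all angles within \<open>[0, pi/3]\<close>, where the cosine is at
  least 1/2, so the terms cannot cancel.\<close>

lemma norm_exp_sum_short:
  fixes K y p :: int
  assumes p: "p > 0" and y: "0 \<le> y" and K: "K > 0" and small: "6 * ((K - 1) * y) \<le> p"
  shows "(of_int K / 2)\<^sup>2 \<le> (cmod (\<Sum>a\<in>{0..<K}. ep p (a * y)))\<^sup>2"
proof -
  have half: "1 / 2 \<le> Re (ep p (a * y))" if a: "a \<in> {0..<K}" for a
  proof -
    define \<theta> where "\<theta> = 2 * pi * real_of_int (a * y) / real_of_int p"
    have "a * y \<le> (K - 1) * y" using a y by (intro mult_right_mono) auto
    then have "6 * (a * y) \<le> p" using small by linarith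
    then have "real_of_int (6 * (a * y)) \<le> real_of_int p" by (simp only: of_int_le_iff)
    then have "6 * real_of_int (a * y) / real_of_int p \<le> 1" using p by (simp add: field_simps)
    then have "pi / 3 * (6 * real_of_int (a * y) / real_of_int p) \<le> pi / 3 * 1"
      by (intro mult_left_mono) auto
    then have "\<theta> \<le> pi / 3" by (simp add: \<theta>_def)
    moreover have "\<theta> \<ge> 0" using a y p by (simp add: \<theta>_def)
    ultimately have "cos (pi / 3) \<le> cos \<theta>" by (intro cos_monotone_0_pi_le) auto
    then show ?thesis by (simp add: ep_def \<theta>_def cos_60)
  qed
  have "of_int K / 2 = (\<Sum>a\<in>{0..<K}. 1 / 2 :: real)" using K by simp
  also have "\<dots> \<le> (\<Sum>a\<in>{0..<K}. Re (ep p (a * y)))" by (rule sum_mono) (rule half)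
  also have "\<dots> \<le> cmod (\<Sum>a\<in>{0..<K}. ep p (a * y))" by (metis Re_sum complex_Re_le_cmod)
  finally show ?thesis using K by (intro power_mono) auto
qed

text \<open>Each \<open>y\<close> in \<open>A\<close> contributes at least \<open>(K/2)^2\<close> to
  the sum over \<open>C\<close> of the squared modulus of a geometric sum. Expanding the square
  gives the exponential sums at all differences \<open>a - a'\<close>, at most
  \<open>K (F 0 + 2 s)\<close> in total; one factor \<open>K\<close> cancels.\<close>

lemma fejer_count:
  fixes K M p :: int
  assumes p: "p > 0" and fin: "finite C" and K: "K > 0" and small: "6 * ((K - 1) * M) \<le> p"
    and A: "A \<subseteq> C" "\<And>y. y \<in> A \<Longrightarrow> 0 \<le> y \<and> y \<le> M"
  shows "real (card A) * of_int K \<le> 4 * real (card C) + 8 * (\<Sum>b\<in>{0<..<K}. cmod (exp_sum p C b))"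
proof -
  define F where "F b = cmod (exp_sum p C b)" for b
  define s where "s = (\<Sum>b\<in>{0<..<K}. F b)"
  have F0: "F 0 \<le> real (card C)" using fin by (simp add: F_def exp_sum_def)
  \<comment> \<open>For fixed \<open>a\<close> the differences take the value 0 once and every other
    value at most once, and opposite values give equal moduli.\<close>
  have row: "(\<Sum>a'\<in>{0..<K}. F (a - a')) \<le> F 0 + 2 * s" if a: "a \<in> {0..<K}" for a
  proof -
    have "{0..<K} = {0..<a} \<union> {a} \<union> {a<..<K}" using a by auto
    moreover have "{0..<a} \<inter> {a<..<K} = {}" by auto
    ultimately have "(\<Sum>a'\<in>{0..<K}. F (a - a'))
        = (\<Sum>a'\<in>{0..<a}. F (a - a')) + F 0 + (\<Sum>a'\<in>{a<..<K}. F (a - a'))"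
      by (simp add: sum.union_disjoint)
    also have "(\<Sum>a'\<in>{0..<a}. F (a - a')) = (\<Sum>b\<in>{0<..a}. F b)"
      by (rule sum.reindex_bij_witness[of _ "\<lambda>b. a - b" "\<lambda>b. a - b"]) auto
    also have "\<dots> \<le> s" unfolding s_def using a by (intro sum_mono2) (auto simp: F_def)
    also have "(\<Sum>a'\<in>{a<..<K}. F (a - a')) = (\<Sum>b\<in>{0<..<K - a}. F b)"
      by (rule sum.reindex_bij_witness[of _ "\<lambda>b. a + b" "\<lambda>b. b - a"])
         (use norm_exp_sum_minus[of p C "b - a" for b] in \<open>auto simp: F_def\<close>)
    also have "\<dots> \<le> s" unfolding s_def using a by (intro sum_mono2) (auto simp: F_def)
    finally show ?thesis by simp
  qed
  have "real (card A) * (of_int K / 2)\<^sup>2 = (\<Sum>y\<in>A. (of_int K / 2)\<^sup>2)" by simp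
  also have "\<dots> \<le> (\<Sum>y\<in>A. (cmod (\<Sum>a\<in>{0..<K}. ep p (a * y)))\<^sup>2)"
  proof (intro sum_mono norm_exp_sum_short[OF p _ K])
    fix y assume y: "y \<in> A"
    have "(K - 1) * y \<le> (K - 1) * M" using A(2)[OF y] K by (intro mult_left_mono) auto
    then show "6 * ((K - 1) * y) \<le> p" using small by linarith
  qed (use A in auto)
  \<comment> \<open>Positivity of the kernel allows the extension from \<open>A\<close> to all of
    \<open>C\<close>.\<close>
  also have "\<dots> \<le> (\<Sum>y\<in>C. (cmod (\<Sum>a\<in>{0..<K}. ep p (a * y)))\<^sup>2)"
    using A(1) fin by (intro sum_mono2) auto
  also have "\<dots> = Re (\<Sum>y\<in>C. \<Sum>a\<in>{0..<K}. \<Sum>a'\<in>{0..<K}. ep p ((a - a') * y))"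
  proof -
    have "complex_of_real ((cmod (\<Sum>a\<in>{0..<K}. ep p (a * y)))\<^sup>2)
        = (\<Sum>a\<in>{0..<K}. \<Sum>a'\<in>{0..<K}. ep p ((a - a') * y))" for y
      unfolding complex_norm_square
      by (simp add: sum_product ep_cnj left_diff_distrib flip: ep_add)
    then have "complex_of_real (\<Sum>y\<in>C. (cmod (\<Sum>a\<in>{0..<K}. ep p (a * y)))\<^sup>2)
        = (\<Sum>y\<in>C. \<Sum>a\<in>{0..<K}. \<Sum>a'\<in>{0..<K}. ep p ((a - a') * y))"
      by (simp only: of_real_sum)
    from arg_cong[OF this, of Re] show ?thesis by simp
  qed
  also have "(\<Sum>y\<in>C. \<Sum>a\<in>{0..<K}. \<Sum>a'\<in>{0..<K}. ep p ((a - a') * y))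
      = (\<Sum>a\<in>{0..<K}. \<Sum>a'\<in>{0..<K}. exp_sum p C (a - a'))"
    unfolding exp_sum_def sum.swap[of _ _ C] ..
  also have "Re \<dots> \<le> cmod \<dots>" by (rule complex_Re_le_cmod)
  also have "\<dots> \<le> (\<Sum>a\<in>{0..<K}. \<Sum>a'\<in>{0..<K}. F (a - a'))"
    unfolding F_def by (intro order_trans[OF norm_sum] sum_mono norm_sum)
  also have "\<dots> \<le> (\<Sum>a\<in>{0..<K}. F 0 + 2 * s)" by (intro sum_mono row)
  also have "\<dots> = of_int K * (F 0 + 2 * s)" using K by simp
  finally have "of_int K * (real (card A) * of_int K) \<le> of_int K * (4 * (F 0 + 2 * s))"
    by (simp add: power2_eq_square algebra_simps)
  then have "real (card A) * of_int K \<le> 4 * (F 0 + 2 * s)" using K by simp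
  then show ?thesis using F0 by (simp add: s_def F_def)
qed

section \<open>Divisors and products\<close>

lemma card_divisors_prime_power_mult:
  fixes q m e :: nat
  assumes q: "prime q" and m: "m > 0"
  shows "card {d. d dvd q ^ e * m} \<le> Suc e * card {d. d dvd m}"
proof -
  have "{d. d dvd q ^ e * m} \<subseteq> (\<lambda>(i, d). q ^ i * d) ` ({..e} \<times> {d. d dvd m})"
  proof
    fix d assume "d \<in> {d. d dvd q ^ e * m}"
    then obtain a b where "d = a * b" "a dvd q ^ e" "b dvd m" using division_decomp by blast
    moreover from this obtain i where "i \<le> e" "a = q ^ i" using divides_primepow_nat[OF q] by blast
    ultimately show "d \<in> (\<lambda>(i, d). q ^ i * d) ` ({..e} \<times> {d. d dvd m})"
      by (intro image_eqI[of _ _ "(i, b)"]) auto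
  qed
  then have "card {d. d dvd q ^ e * m} \<le> card ({..e} \<times> {d. d dvd m})"
    using m by (intro surj_card_le) auto
  then show ?thesis by (simp add: card_cartesian_product)
qed

text \<open>Induction on the bound for the primes: each new prime costs at most one constant factor
  \<open>M\<close>.\<close>

lemma card_divisors_smooth:
  fixes \<epsilon> :: real
  assumes \<epsilon>: "\<epsilon> > 0"
  shows "\<exists>C\<ge>1. \<forall>n>0. (\<forall>q. prime q \<longrightarrow> q dvd n \<longrightarrow> q < k) \<longrightarrow>
    real (card {d::nat. d dvd n}) \<le> C * real n powr \<epsilon>"
proof (induction k)
  case 0
  have "real (card {d::nat. d dvd n}) \<le> 1 * real n powr \<epsilon>"
    if "n > 0" "\<forall>q. prime q \<longrightarrow> q dvd n \<longrightarrow> q < 0" for n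
  proof -
    have "n = 1" using that(2) prime_factor_nat[of n] by auto
    then show ?thesis by simp
  qed
  then show ?case by (intro exI[of _ 1]) auto
next
  case (Suc k)
  then obtain C where C: "C \<ge> 1" "\<And>n. n > 0 \<Longrightarrow> (\<And>q. prime q \<Longrightarrow> q dvd n \<Longrightarrow> q < k) \<Longrightarrow>
    real (card {d::nat. d dvd n}) \<le> C * real n powr \<epsilon>" by blast
  \<comment> \<open>Chosen so that \<open>M (1 + e \<epsilon> ln 2)\<close> is at least
    \<open>e + 1\<close>, while \<open>1 + e \<epsilon> ln 2\<close> is at most
    \<open>k^(e \<epsilon>)\<close> for every \<open>k \<ge> 2\<close>.\<close>
  define M where "M = 1 + 1 / (\<epsilon> * ln 2)"
  have M: "M \<ge> 1" using \<epsilon> by (simp add: M_def)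
  have "real (card {d::nat. d dvd n}) \<le> (C * M) * real n powr \<epsilon>"
    if n: "n > 0" "\<forall>q. prime q \<longrightarrow> q dvd n \<longrightarrow> q < Suc k" for n
  proof (cases "prime k")
    case False
    have "q < k" if "prime q" "q dvd n" for q
      using n(2) that False by (metis less_antisym)
    then have "real (card {d::nat. d dvd n}) \<le> C * real n powr \<epsilon>" using C(2) n by blast
    also have "\<dots> \<le> (C * M) * real n powr \<epsilon>" using C(1) M by (intro mult_right_mono) auto
    finally show ?thesis .
  next
    case True
    obtain e m where em: "\<not> k dvd m" "n = k ^ e * m"
      using multiplicity_decompose'[of n k] n(1) True not_prime_unit by (metis neq0_conv)
    have m: "m > 0" using n(1) em(2) by (auto intro: Nat.gr0I)
    have "q < k" if "prime q" "q dvd m" for q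
    proof -
      have "q < Suc k" using n(2) that em(2) by auto
      moreover have "q \<noteq> k" using em(1) that by auto
      ultimately show ?thesis by simp
    qed
    then have Dm: "real (card {d::nat. d dvd m}) \<le> C * real m powr \<epsilon>" using C(2) m by blast
    have k2: "k \<ge> 2" using True by (rule prime_ge_2_nat)
    have "1 + real e * (\<epsilon> * ln 2) \<le> exp (real e * (\<epsilon> * ln 2))" by (rule exp_ge_add_one_self)
    also have "\<dots> \<le> exp (real e * (\<epsilon> * ln (real k)))"
      using k2 \<epsilon> by (intro iffD2[OF exp_le_cancel_iff] mult_left_mono) auto
    also have "\<dots> = real (k ^ e) powr \<epsilon>" using k2 by (simp add: powr_def ln_realpow algebra_simps)
    finally have "M * (1 + real e * (\<epsilon> * ln 2)) \<le> M * real (k ^ e) powr \<epsilon>"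
      using M by (intro mult_left_mono) auto
    moreover have "M * (1 + real e * (\<epsilon> * ln 2)) = M + real e * (\<epsilon> * ln 2) + real e"
      using \<epsilon> by (simp add: M_def field_simps)
    moreover have "real e * (\<epsilon> * ln 2) \<ge> 0" using \<epsilon> by simp
    ultimately have e: "real (Suc e) \<le> M * real (k ^ e) powr \<epsilon>" using M by simp
    have "real (card {d::nat. d dvd n}) \<le> real (Suc e) * real (card {d. d dvd m})"
      using card_divisors_prime_power_mult[OF True m, of e] unfolding em(2)
      by (metis of_nat_le_iff of_nat_mult)
    also have "\<dots> \<le> (M * real (k ^ e) powr \<epsilon>) * (C * real m powr \<epsilon>)"
      using e Dm M by (intro mult_mono) auto
    also have "\<dots> = (C * M) * real n powr \<epsilon>"
      unfolding em(2) of_nat_mult by (simp add: powr_mult)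
    finally show ?thesis .
  qed
  moreover have "C * M \<ge> 1" using C(1) M mult_mono[of 1 C 1 M] by simp
  ultimately show ?case by blast
qed

text \<open>A prime \<open>q \<ge> 2^(1/\<epsilon>)\<close> satisfies
  \<open>q^\<epsilon> \<ge> 2\<close>, which pays for the doubling that one factor \<open>q\<close>
  can cause. Only the smaller primes contribute to the constant.\<close>

theorem card_divisors_le_powr:
  fixes \<epsilon> :: real
  assumes \<epsilon>: "\<epsilon> > 0"
  shows "\<exists>C\<ge>1. \<forall>n>0. real (card {d::nat. d dvd n}) \<le> C * real n powr \<epsilon>"
proof -
  obtain k :: nat where k: "2 powr (1 / \<epsilon>) \<le> real k" using real_arch_simple by blast
  obtain C where C: "C \<ge> 1" "\<And>n. n > 0 \<Longrightarrow> (\<And>q. prime q \<Longrightarrow> q dvd n \<Longrightarrow> q < k) \<Longrightarrow>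
    real (card {d::nat. d dvd n}) \<le> C * real n powr \<epsilon>"
    using card_divisors_smooth[OF \<epsilon>, of k] by blast
  have "n > 0 \<Longrightarrow> real (card {d::nat. d dvd n}) \<le> C * real n powr \<epsilon>" for n
  proof (induction n rule: less_induct)
    case (less n)
    show ?case
    proof (cases "\<exists>q. prime q \<and> q dvd n \<and> k \<le> q")
      case False
      then show ?thesis using C(2)[of n] less.prems by (meson not_le)
    next
      case True
      then obtain q m where q: "prime q" "k \<le> q" "n = q * m" by (auto simp: dvd_def)
      have m: "m > 0" using less.prems q(3) by (auto intro: Nat.gr0I)
      have "m < n" using q(3) m prime_gt_1_nat[OF q(1)] by simp
      have "2 = (2 powr (1 / \<epsilon>)) powr \<epsilon>" using \<epsilon> by (simp add: powr_powr)
      also have "\<dots> \<le> real q powr \<epsilon>" using k q(2) \<epsilon> by (intro powr_mono2) auto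
      finally have q2: "2 \<le> real q powr \<epsilon>" .
      have "card {d. d dvd n} \<le> 2 * card {d. d dvd m}"
        using card_divisors_prime_power_mult[OF q(1) m, of 1] by (simp add: q(3))
      then have "real (card {d. d dvd n}) \<le> 2 * real (card {d. d dvd m})" by linarith
      also have "\<dots> \<le> real q powr \<epsilon> * (C * real m powr \<epsilon>)"
        using q2 less.IH[OF \<open>m < n\<close> m] by (intro mult_mono) auto
      also have "\<dots> = C * real n powr \<epsilon>" by (simp add: q(3) powr_mult)
      finally show ?thesis .
    qed
  qed
  then show ?thesis using C(1) by blast
qed

section \<open>Counting elements of cosets through their products\<close>

lemma card_int_divisors:
  assumes "n > 0"
  shows "card {a::int. 0 < a \<and> a dvd n} = card {d::nat. d dvd nat n}"
proof (rule bij_betw_same_card[of nat])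
  show "bij_betw nat {a::int. 0 < a \<and> a dvd n} {d::nat. d dvd nat n}"
  proof (rule bij_betwI[of _ _ _ int])
    show "nat \<in> {a. 0 < a \<and> a dvd n} \<rightarrow> {d. d dvd nat n}"
      using assms by (auto simp: nat_dvd_iff)
    show "int \<in> {d. d dvd nat n} \<rightarrow> {a. 0 < a \<and> a dvd n}"
      using assms by (auto simp flip: int_dvd_int_iff) (metis dvd_0_left_iff gr0I of_nat_0 order_less_irrefl)
  qed auto
qed

lemma card_le_fibre_bound:
  fixes D :: real
  assumes fin: "finite X" and fib: "\<And>y. y \<in> f ` X \<Longrightarrow> real (card {x \<in> X. f x = y}) \<le> D"
  shows "real (card X) \<le> D * real (card (f ` X))"
proof -
  have "card X = (\<Sum>y\<in>f ` X. card {x \<in> X. f x = y})"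
    using sum.image_gen[OF fin, of "\<lambda>_. 1::nat" f] by simp
  then have "real (card X) = (\<Sum>y\<in>f ` X. real (card {x \<in> X. f x = y}))" by simp
  also have "\<dots> \<le> (\<Sum>y\<in>f ` X. D)" by (rule sum_mono) (rule fib)
  finally show ?thesis by (simp add: mult.commute)
qed

text \<open>Quotient and remainder by \<open>p\<close> determine \<open>n\<close>; there are
  \<open>L div p + 1\<close> quotients, and each allows at most \<open>T\<close> remainders.\<close>

lemma card_power_residues_upto:
  fixes p L :: int
  assumes p: "prime p" and T: "T > 0" and \<delta>: "\<not> p dvd \<delta>" and L: "L \<ge> 0"
  shows "real (card {n. 0 < n \<and> n \<le> L \<and> [n ^ T = \<delta>] (mod p)}) \<le> real T * (of_int L / of_int p + 1)"
proof -
  define X where "X = {n. 0 < n \<and> n \<le> L \<and> [n ^ T = \<delta>] (mod p)}"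
  have p0: "p > 0" using p by (rule prime_gt_0_int)
  have "card X \<le> card ({0..L div p} \<times> pow_res p T \<delta>)"
  proof (rule card_inj_on_le)
    show "inj_on (\<lambda>n. (n div p, n mod p)) X"
    proof (rule inj_onI)
      fix m n :: int assume "(m div p, m mod p) = (n div p, n mod p)"
      then have "m div p * p + m mod p = n div p * p + n mod p" by simp
      then show "m = n" by (simp only: div_mult_mod_eq)
    qed
    show "(\<lambda>n. (n div p, n mod p)) ` X \<subseteq> {0..L div p} \<times> pow_res p T \<delta>"
    proof (rule image_subsetI)
      fix n assume n: "n \<in> X"
      have c: "[(n mod p) ^ T = \<delta>] (mod p)"
      proof -
        have "[(n mod p) ^ T = n ^ T] (mod p)" by (intro cong_pow) simp
        moreover have "[n ^ T = \<delta>] (mod p)" using n by (simp add: X_def)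
        ultimately show ?thesis by (rule cong_trans)
      qed
      have "n mod p \<noteq> 0"
      proof
        assume "n mod p = 0"
        then have "[0 = \<delta>] (mod p)" using c T by (simp add: power_0_left)
        then show False using \<delta> by (auto dest: cong_sym simp: cong_0_iff)
      qed
      then have "0 < n mod p" "n mod p < p"
        using pos_mod_sign[OF p0, of n] pos_mod_bound[OF p0, of n] by linarith+
      moreover have "0 \<le> n div p" "n div p \<le> L div p"
        using n p0 by (auto simp: X_def pos_imp_zdiv_nonneg_iff intro: zdiv_mono1)
      ultimately show "(n div p, n mod p) \<in> {0..L div p} \<times> pow_res p T \<delta>"
        using c by (simp add: pow_res_def)
    qed
  qed simp
  also have "\<dots> = nat (L div p + 1) * card (pow_res p T \<delta>)" by (simp add: card_cartesian_product)
  also have "\<dots> \<le> nat (L div p + 1) * T" using card_pow_res[OF p T] by (intro mult_left_mono) auto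
  finally have "real (card X) \<le> real (nat (L div p + 1)) * real T" by (metis of_nat_le_iff of_nat_mult)
  also have "real (nat (L div p + 1)) = of_int (L div p) + 1"
    using L p0 by (simp add: pos_imp_zdiv_nonneg_iff)
  also have "of_int (L div p) \<le> (of_int L / of_int p :: real)" by (rule real_of_int_div4)
  finally show ?thesis by (simp add: X_def mult.commute mult_left_mono)
qed

text \<open>Products of two elements of \<open>A\<close> are at most \<open>M^2\<close> and have the
  same \<open>T\<close>-th power \<open>\<gamma>^2\<close> modulo \<open>p\<close>; each arises from
  at most \<open>D\<close> pairs, a pair being fixed by its first entry.\<close>

lemma card_pairs_power_residue:
  fixes p M :: int and D :: real
  assumes p: "prime p" and T: "T > 0" and M: "0 \<le> M" "M \<le> p"
    and A: "A \<subseteq> pow_res p T \<gamma>" "\<And>y. y \<in> A \<Longrightarrow> y \<le> M"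
    and D: "\<And>n. 0 < n \<Longrightarrow> n \<le> p\<^sup>2 \<Longrightarrow> real (card {a::int. 0 < a \<and> a dvd n}) \<le> D"
  shows "(real (card A))\<^sup>2 \<le> D * (real T * ((of_int M)\<^sup>2 / of_int p + 1))"
proof (cases "A = {}")
  case True
  have "D \<ge> 0" using D[of 1] prime_ge_1_int[OF p] by (simp add: order_trans[OF of_nat_0_le_iff])
  then show ?thesis using True prime_gt_0_int[OF p] by simp
next
  case False
  define f where "f = (\<lambda>(a, b). a * b :: int)"
  have finA: "finite A" using A(1) by (rule finite_subset) simp
  have pos: "0 < y" "y \<le> M" "[y ^ T = \<gamma>] (mod p)" if "y \<in> A" for y
    using that A by (auto simp: pow_res_def)
  obtain c where "c \<in> A" using False by blast
  then have \<gamma>: "\<not> p dvd \<gamma>\<^sup>2" using A(1) pow_res_not_dvd(2)[OF p] p by (metis prime_dvd_power subsetD)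
  have D0: "D \<ge> 0" using D[of 1] prime_ge_1_int[OF p] by (simp add: order_trans[OF of_nat_0_le_iff])
  have range: "0 < f x \<and> f x \<le> M\<^sup>2 \<and> [f x ^ T = \<gamma>\<^sup>2] (mod p)" if x: "x \<in> A \<times> A" for x
  proof -
    obtain a b where ab: "x = (a, b)" "a \<in> A" "b \<in> A" using x by auto
    have "a * b \<le> M * M" using pos[OF ab(2)] pos[OF ab(3)] M by (intro mult_mono) auto
    moreover have "[(a * b) ^ T = \<gamma> * \<gamma>] (mod p)"
      unfolding power_mult_distrib using pos[OF ab(2)] pos[OF ab(3)] by (intro cong_mult)
    ultimately show ?thesis using pos[OF ab(2)] pos[OF ab(3)] by (simp add: f_def ab(1) power2_eq_square)
  qed
  have "real (card (A \<times> A)) \<le> D * real (card (f ` (A \<times> A)))"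
  proof (rule card_le_fibre_bound)
    fix n assume "n \<in> f ` (A \<times> A)"
    then have n: "0 < n" "n \<le> M\<^sup>2" using range by auto
    have "M\<^sup>2 \<le> p\<^sup>2" using M by (intro power_mono) auto
    have "card {x \<in> A \<times> A. f x = n} \<le> card {a::int. 0 < a \<and> a dvd n}"
    proof (rule card_inj_on_le[of fst])
      show "inj_on fst {x \<in> A \<times> A. f x = n}"
        using n by (auto simp: inj_on_def f_def)
      show "fst ` {x \<in> A \<times> A. f x = n} \<subseteq> {a. 0 < a \<and> a dvd n}"
        using pos(1) by (auto simp: f_def)
      show "finite {a. 0 < a \<and> a dvd n}"
        using n by (intro finite_subset[OF _ finite_divisors_int[of n]]) auto
    qed
    then show "real (card {x \<in> A \<times> A. f x = n}) \<le> D"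
      using D[of n] n \<open>M\<^sup>2 \<le> p\<^sup>2\<close> by linarith
  qed (simp add: finA)
  also have "\<dots> \<le> D * real (card {n. 0 < n \<and> n \<le> M\<^sup>2 \<and> [n ^ T = \<gamma>\<^sup>2] (mod p)})"
  proof (intro mult_left_mono D0 of_nat_mono card_mono)
    show "finite {n. 0 < n \<and> n \<le> M\<^sup>2 \<and> [n ^ T = \<gamma>\<^sup>2] (mod p)}"
      by (rule finite_subset[of _ "{0..M\<^sup>2}"]) auto
    show "f ` (A \<times> A) \<subseteq> {n. 0 < n \<and> n \<le> M\<^sup>2 \<and> [n ^ T = \<gamma>\<^sup>2] (mod p)}"
      by (rule image_subsetI, rule CollectI) (rule range)
  qed
  also have "\<dots> \<le> D * (real T * (of_int (M\<^sup>2) / of_int p + 1))"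
    by (intro mult_left_mono D0 card_power_residues_upto[OF p T \<gamma>]) simp
  finally show ?thesis by (simp add: card_cartesian_product power2_eq_square)
qed

text \<open>Products of three such elements stay below \<open>K^3 \<le> p\<close>, so they are
  themselves members of one coset, of which there are at most \<open>T\<close>. Two divisors of the
  product determine the triple, hence \<open>D^2\<close>.\<close>

lemma card_triples_power_residue:
  fixes p K :: int and D :: real
  assumes p: "prime p" and T: "T > 0" and K: "0 \<le> K" "K ^ 3 \<le> p"
    and D: "\<And>n. 0 < n \<Longrightarrow> n \<le> p\<^sup>2 \<Longrightarrow> real (card {a::int. 0 < a \<and> a dvd n}) \<le> D"
  shows "real (card {a \<in> {0<..<K}. [a ^ T = \<delta>] (mod p)}) ^ 3 \<le> D\<^sup>2 * real T"
proof -
  define A where "A = {a \<in> {0<..<K}. [a ^ T = \<delta>] (mod p)}"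
  define f where "f = (\<lambda>(a, b, c). a * b * c :: int)"
  have finA: "finite A" unfolding A_def by (rule finite_subset[of _ "{0<..<K}"]) auto
  have D0: "D \<ge> 0" using D[of 1] prime_ge_1_int[OF p] by (simp add: order_trans[OF of_nat_0_le_iff])
  have range: "f x \<in> pow_res p T (\<delta> ^ 3)" if x: "x \<in> A \<times> A \<times> A" for x
  proof -
    obtain a b c where abc: "x = (a, b, c)" "a \<in> A" "b \<in> A" "c \<in> A" using x by auto
    have "a * b * c < K * K * K" using abc by (intro mult_strict_mono) (auto simp: A_def)
    then have "a * b * c < p" using K(2) by (simp add: power3_eq_cube)
    moreover have "[(a * b * c) ^ T = \<delta> * \<delta> * \<delta>] (mod p)"
      unfolding power_mult_distrib using abc by (intro cong_mult) (auto simp: A_def)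
    ultimately show ?thesis using abc by (simp add: f_def pow_res_def power3_eq_cube A_def)
  qed
  have "real (card (A \<times> A \<times> A)) \<le> D\<^sup>2 * real (card (f ` (A \<times> A \<times> A)))"
  proof (rule card_le_fibre_bound)
    fix n assume "n \<in> f ` (A \<times> A \<times> A)"
    then have "n \<in> pow_res p T (\<delta> ^ 3)" using range by auto
    then have n: "0 < n" "n \<le> p" by (auto simp: pow_res_def)
    define Q where "Q = {a::int. 0 < a \<and> a dvd n}"
    have finQ: "finite Q" unfolding Q_def
      using n by (intro finite_subset[OF _ finite_divisors_int[of n]]) auto
    have "card {x \<in> A \<times> A \<times> A. f x = n} \<le> card (Q \<times> Q)"
    proof (rule card_inj_on_le[of "\<lambda>(a, b, c). (a, b)"])
      show "inj_on (\<lambda>(a, b, c). (a, b)) {x \<in> A \<times> A \<times> A. f x = n}"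
        using n by (auto simp: inj_on_def f_def)
      show "(\<lambda>(a, b, c). (a, b)) ` {x \<in> A \<times> A \<times> A. f x = n} \<subseteq> Q \<times> Q"
        by (auto simp: f_def Q_def A_def)
    qed (simp add: finQ)
    then have "real (card {x \<in> A \<times> A \<times> A. f x = n}) \<le> (real (card Q))\<^sup>2"
      by (simp add: card_cartesian_product power2_eq_square flip: of_nat_mult)
    also have "\<dots> \<le> D\<^sup>2"
    proof (intro power_mono)
      have "p \<le> p\<^sup>2" using prime_ge_1_int[OF p] by (simp add: self_le_power)
      then show "real (card Q) \<le> D" unfolding Q_def using n by (intro D) auto
    qed simp
    finally show "real (card {x \<in> A \<times> A \<times> A. f x = n}) \<le> D\<^sup>2" .
  qed (simp add: finA)
  also have "\<dots> \<le> D\<^sup>2 * real T"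
  proof (intro mult_left_mono of_nat_mono)
    have "card (f ` (A \<times> A \<times> A)) \<le> card (pow_res p T (\<delta> ^ 3))" using range by (intro card_mono) auto
    also have "\<dots> \<le> T" by (rule card_pow_res[OF p T])
    finally show "card (f ` (A \<times> A \<times> A)) \<le> T" .
  qed simp
  finally show ?thesis by (simp add: A_def card_cartesian_product power3_eq_cube)
qed

section \<open>Counting multiples of a fixed divisor\<close>

text \<open>Hoelder's inequality with exponent 4, by applying Cauchy-Schwarz twice.\<close>

lemma sum_le_fourth_root_mean:
  fixes f :: "'a \<Rightarrow> real"
  shows "(\<Sum>i\<in>I. f i) ^ 4 \<le> (real (card I)) ^ 3 * (\<Sum>i\<in>I. f i ^ 4)"
proof -
  have p4: "x ^ 4 = (x\<^sup>2)\<^sup>2" for x :: real by (simp flip: power_mult)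
  have "(\<Sum>i\<in>I. f i) ^ 4 \<le> ((\<Sum>i\<in>I. (f i)\<^sup>2) * real (card I))\<^sup>2"
    unfolding p4 by (intro power_mono sum_squared_le_sum_of_squares) simp
  also have "\<dots> = (\<Sum>i\<in>I. (f i)\<^sup>2)\<^sup>2 * (real (card I))\<^sup>2" by (rule power_mult_distrib)
  also have "\<dots> \<le> ((\<Sum>i\<in>I. f i ^ 4) * real (card I)) * (real (card I))\<^sup>2"
    unfolding p4 by (intro mult_right_mono sum_squared_le_sum_of_squares) simp
  finally show ?thesis by (simp add: power2_eq_square power3_eq_cube algebra_simps)
qed

lemma count_small_divisor:
  fixes p M :: int and D :: real and d t :: nat
  assumes p: "prime p" and t: "t > 0" and d: "d > 0" and dp: "int d ^ 3 < p"
    and dM: "int d * M \<le> p"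
    and A: "A \<subseteq> pow_res p (t * d) \<gamma>" "\<And>y. y \<in> A \<Longrightarrow> y \<le> M"
    and D: "D \<ge> 1" "\<And>n. 0 < n \<Longrightarrow> n \<le> p\<^sup>2 \<Longrightarrow> real (card {a::int. 0 < a \<and> a dvd n}) \<le> D"
  shows "real (card A) \<le> 32 * D * (real t + of_int p powr (1/3) * real t powr (1/2))"
proof -
  define T where "T = t * d"
  define C where "C = pow_res p T \<gamma>"
  \<comment> \<open>\<open>6 (K - 1) \<le> d\<close> keeps the angles small as
    \<open>d M \<le> p\<close>; \<open>d \<le> 6 K\<close> makes the main term \<open>T / K\<close>
    of size \<open>O(t)\<close>.\<close>
  define K where "K = int d div 6 + 1"
  define u where "u = (of_int p :: real) powr (1/3)"
  define X where "X = u * real t powr (1/2)"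
  define s where "s = (\<Sum>b\<in>{0<..<K}. cmod (exp_sum p C b))"
  have p0: "p > 0" using p by (rule prime_gt_0_int)
  have T: "T > 0" using t d by (simp add: T_def)
  have K: "0 < K" "K \<le> int d" "int d \<le> 6 * K" "6 * (K - 1) \<le> int d" using d by (auto simp: K_def)
  have u0: "u > 0" using p0 by (simp add: u_def)
  have u3: "u ^ 3 = of_int p" using p0 by (simp add: u_def powr_powr flip: powr_numeral)
  have X0: "X > 0" using u0 t by (simp add: X_def)
  have X2: "X\<^sup>2 = u\<^sup>2 * real t" using t
    by (simp add: X_def power_mult_distrib powr_half_sqrt)
  have du: "real d < u"
  proof (rule power_less_imp_less_base)
    have "real_of_int (int d ^ 3) < of_int p" using dp by (simp only: of_int_less_iff)
    then show "real d ^ 3 < u ^ 3" by (simp add: u3)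
  qed (use u0 in simp)
  have count: "real (card A) * of_int K \<le> 4 * real (card C) + 8 * s"
    unfolding s_def C_def
  proof (rule fejer_count[OF p0 _ K(1)])
    show "6 * ((K - 1) * M) \<le> p"
    proof (cases "M \<ge> 0")
      case True
      then have "6 * (K - 1) * M \<le> int d * M" using K(4) by (intro mult_right_mono)
      also note dM
      finally show ?thesis by (simp only: mult.assoc)
    next
      case False
      then have "(K - 1) * M \<le> 0" using K(1) by (intro mult_nonneg_nonpos) auto
      then show ?thesis using p0 by linarith
    qed
    show "0 \<le> y \<and> y \<le> M" if "y \<in> A" for y
      using that A by (auto simp: pow_res_def)
  qed (use A(1) in \<open>auto simp: T_def\<close>)
  have Kr: "real_of_int K > 0" "real d \<le> 6 * of_int K" using K by linarith+
  have "card C \<le> T" unfolding C_def by (rule card_pow_res[OF p T])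
  then have "real (card C) \<le> real t * real d" by (simp add: T_def flip: of_nat_mult)
  also have "\<dots> \<le> real t * (6 * of_int K)" using Kr by (intro mult_left_mono) auto
  finally have CK: "4 * real (card C) \<le> 24 * real t * of_int K" by (simp add: mult_ac)
  have coprime: "\<not> p dvd b" if "b \<in> {0<..<K}" for b
  proof
    assume "p dvd b"
    then have "p \<le> b" using that by (intro zdvd_imp_le) auto
    moreover have "int d \<le> int d ^ 3" using d by (intro self_le_power) auto
    moreover have "b < K" using that by simp
    ultimately show False using K(2) dp by linarith
  qed
  have s: "8 * s \<le> 32 * D * X * of_int K"
  proof (cases "u \<le> real t")
    case True
    have "s \<le> (\<Sum>b\<in>{0<..<K}. sqrt (of_int p))"
      unfolding s_def C_def by (intro sum_mono exp_sum_pow_res_sqrt p coprime)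
    also have "\<dots> = (of_int K - 1) * sqrt (of_int p)" using K(1) by simp
    also have "\<dots> \<le> of_int K * X"
    proof (intro mult_mono)
      \<comment> \<open>\<open>p = u^3 \<le> u^2 t\<close>, since \<open>u \<le> t\<close> in this
        case.\<close>
      have "of_int p \<le> X\<^sup>2" unfolding X2 u3[symmetric]
        using True u0 by (simp add: power2_eq_square power3_eq_cube)
      then show "sqrt (of_int p) \<le> X" using X0 by (intro real_le_lsqrt) auto
    qed (use K p0 in auto)
    finally have "8 * s \<le> 8 * X * of_int K" by (simp add: mult_ac)
    also have "\<dots> \<le> 32 * D * X * of_int K"
      using D(1) X0 Kr by (intro mult_right_mono) auto
    finally show ?thesis .
  next
    case False
    \<comment> \<open>In terms of \<open>w\<close>, a coset has at most \<open>w D\<close> elements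
      below \<open>K\<close>, and a nonzero difference at most \<open>24 w^2\<close>
      representations.\<close>
    define w where "w = real T powr (1/3)"
    have w3: "w ^ 3 = real T" using T by (simp add: w_def powr_powr flip: powr_numeral)
    have w1: "w \<ge> 1" using T by (simp add: w_def ge_one_powr_ge_zero)
    \<comment> \<open>Both \<open>t\<close> and \<open>d\<close> lie below \<open>p^(1/3)\<close>;
      this gives the condition \<open>T^3 \<le> p^2\<close> of the Stepanov bound.\<close>
    have Tu: "real T < u\<^sup>2"
      unfolding T_def power2_eq_square of_nat_mult using False du u0 t by (intro mult_strict_mono) auto
    have "real T ^ 3 \<le> (u\<^sup>2) ^ 3" using Tu by (intro power_mono) auto
    also have "\<dots> = (of_int p)\<^sup>2" by (simp flip: u3 power_mult)
    finally have "real_of_int (int T ^ 3) \<le> real_of_int (p\<^sup>2)" by simp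
    then have T3: "int T ^ 3 \<le> p\<^sup>2" by (simp only: of_int_le_iff)
    define R where "R = nat \<lfloor>24 * w\<^sup>2\<rfloor>"
    have R: "card {y \<in> pow_res p T \<gamma>. [(y - h) ^ T = \<gamma>] (mod p)} \<le> R" (is "?r \<le> R")
      if h: "\<not> p dvd h" for h
    proof -
      have "real (?r ^ 3) \<le> real (24 ^ 3 * T\<^sup>2)"
        using card_pow_res_shift[OF p T T3 h, of \<gamma>] by (simp only: of_nat_le_iff)
      also have "\<dots> = (24 * w\<^sup>2) ^ 3"
        by (simp add: power_mult_distrib flip: w3 power_mult)
      finally have "real ?r ^ 3 \<le> (24 * w\<^sup>2) ^ 3" by simp
      then have "real ?r \<le> 24 * w\<^sup>2"
        using power_le_imp_le_base[of "real ?r" 2 "24 * w\<^sup>2"] by simp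
      then show ?thesis unfolding R_def by linarith
    qed
    have Rw: "1 + real R \<le> 25 * w\<^sup>2"
    proof -
      have "real R \<le> 24 * w\<^sup>2" unfolding R_def by simp
      moreover have "1 \<le> w\<^sup>2" using w1 by simp
      ultimately show ?thesis by linarith
    qed
    have n: "real (card {a \<in> {0<..<K}. [a ^ T = \<delta>] (mod p)}) \<le> w * D" (is "?n \<le> _") for \<delta>
    proof (rule power_le_imp_le_base)
      have "K ^ 3 \<le> int d ^ 3" using K by (intro power_mono) auto
      then have K3: "K ^ 3 \<le> p" using dp by linarith
      have "?n ^ 3 \<le> D\<^sup>2 * real T"
        using K(1) by (intro card_triples_power_residue[OF p T _ K3 D(2)]) auto
      also have "\<dots> \<le> D ^ 3 * real T" using D(1) by (intro mult_right_mono power_increasing) auto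
      also have "\<dots> = (w * D) ^ 3" by (simp add: power_mult_distrib w3)
      finally show "?n ^ Suc 2 \<le> (w * D) ^ Suc 2" by (simp add: numeral_3_eq_3)
    qed (use w1 D(1) in auto)
    have "s ^ 4 \<le> (real (card {0<..<K})) ^ 3 * (\<Sum>b\<in>{0<..<K}. cmod (exp_sum p C b) ^ 4)"
      unfolding s_def by (rule sum_le_fourth_root_mean)
    also have "\<dots> \<le> of_int K ^ 3 * (w * D * of_int p * real T * (1 + real R))"
    proof (intro mult_mono power_mono)
      show "(\<Sum>b\<in>{0<..<K}. cmod (exp_sum p C b) ^ 4) \<le> w * D * of_int p * real T * (1 + real R)"
        unfolding C_def by (rule fourth_moment_pow_res[OF p T _ coprime n R]) auto
      show "real (card {0<..<K}) \<le> of_int K" using K(1) by simp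
    qed (use K(1) in \<open>auto intro: sum_nonneg\<close>)
    also have "\<dots> \<le> of_int K ^ 3 * (w * D * of_int p * real T * (25 * w\<^sup>2))"
      using Rw w1 D(1) p0 K(1) by (intro mult_left_mono) auto
    also have "\<dots> = 25 * D * of_int p * of_int K ^ 3 * (w ^ 3 * real T)"
      by (simp add: power2_eq_square power3_eq_cube)
    also have "\<dots> = 25 * D * of_int p * of_int K ^ 3 * (real t * real t * (real d * real d))"
      by (simp add: w3 T_def)
    \<comment> \<open>One factor \<open>d\<close> is bounded by \<open>6 K\<close> and the other by
      \<open>u\<close>, which completes \<open>K^4\<close> and leaves
      \<open>p u t^2 = X^4\<close>.\<close>
    also have "\<dots> \<le> 25 * D * of_int p * of_int K ^ 3 * (real t * real t * (6 * of_int K * u))"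
      using Kr du D(1) p0 by (intro mult_left_mono mult_mono) auto
    also have "\<dots> = 150 * D * (of_int K ^ 4 * (of_int p * u * (real t)\<^sup>2))"
      by (simp add: power2_eq_square power3_eq_cube power4_eq_xxxx)
    also have "of_int p * u * (real t)\<^sup>2 = (X\<^sup>2)\<^sup>2"
      unfolding X2 by (simp add: power2_eq_square power3_eq_cube flip: u3)
    \<comment> \<open>Rounded up to a perfect fourth power: \<open>150 \<le> 4^4\<close> and
      \<open>D \<le> D^4\<close>.\<close>
    also have "150 * D * (of_int K ^ 4 * (X\<^sup>2)\<^sup>2) \<le> 256 * D ^ 4 * (of_int K ^ 4 * (X\<^sup>2)\<^sup>2)"
      using D(1) self_le_power[of D 4] by (intro mult_right_mono mult_mono) auto
    also have "\<dots> = (4 * D * X * of_int K) ^ 4"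
      by (simp add: power_mult_distrib power2_eq_square power4_eq_xxxx)
    finally have "s \<le> 4 * D * X * of_int K"
      using D(1) X0 Kr(1) power_le_imp_le_base[of s 3 "4 * D * X * of_int K"] by simp
    then show ?thesis by simp
  qed
  have "real (card A) * of_int K \<le> (24 * real t + 32 * D * X) * of_int K"
    using count CK s by (simp add: algebra_simps)
  then have "real (card A) \<le> 24 * real t + 32 * D * X" using Kr(1) by simp
  also have "24 * real t \<le> 32 * D * real t" using D(1) by (intro mult_right_mono) auto
  finally show ?thesis by (simp add: X_def u_def algebra_simps)
qed

text \<open>Writing \<open>x = d y\<close> places \<open>y \<le> p / d\<close> in one coset of the
  \<open>T\<close>-th roots of unity; the three ranges of \<open>d\<close> are separated by
  \<open>u = p^(1/3)\<close> and \<open>u^2\<close>.\<close>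

lemma count_divisor:
  fixes p :: int and D :: real and d t :: nat
  assumes p: "prime p" and t: "t > 0" and d: "d > 0" and td: "int (t * d) < p"
    and D: "D \<ge> 1" "\<And>n. 0 < n \<Longrightarrow> n \<le> p\<^sup>2 \<Longrightarrow> real (card {a::int. 0 < a \<and> a dvd n}) \<le> D"
  shows "real (card {x \<in> {0<..<p}. int d dvd x \<and> [x ^ (t * d) = 1] (mod p)})
    \<le> 32 * D * (real t + of_int p powr (1/3) * real t powr (1/2))"
proof -
  define T where "T = t * d"
  define M where "M = p div int d"
  define u where "u = (of_int p :: real) powr (1/3)"
  define X where "X = u * real t powr (1/2)"
  define A where "A = {y. int d * y \<in> {0<..<p} \<and> [(int d * y) ^ T = 1] (mod p)}"
  have p0: "p > 0" using p by (rule prime_gt_0_int)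
  have T: "T > 0" using t d by (simp add: T_def)
  have "d \<le> t * d" using t by simp
  then have dp: "int d < p" using td by linarith
  have u0: "u > 0" using p0 by (simp add: u_def)
  have u3: "u ^ 3 = of_int p" using p0 by (simp add: u_def powr_powr flip: powr_numeral)
  have t1: "real t powr (1/2) \<ge> 1" using t by (simp add: ge_one_powr_ge_zero)
  have X0: "X > 0" using u0 t by (simp add: X_def)
  have X2: "X\<^sup>2 = u\<^sup>2 * real t" using t
    by (simp add: X_def power_mult_distrib powr_half_sqrt)
  have "bij_betw (\<lambda>y. int d * y) A {x \<in> {0<..<p}. int d dvd x \<and> [x ^ T = 1] (mod p)}"
    unfolding bij_betw_def A_def using d by (auto simp: inj_on_def)
  then have cardA: "card {x \<in> {0<..<p}. int d dvd x \<and> [x ^ T = 1] (mod p)} = card A"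
    by (rule bij_betw_same_card[symmetric])
  have Apos: "0 < y" "y \<le> M" "y < p" if "y \<in> A" for y
  proof -
    have dy: "0 < int d * y" "int d * y < p" using that by (auto simp: A_def)
    then show "0 < y" using d by (simp add: zero_less_mult_iff)
    then have "y \<le> int d * y" using d by simp
    then show "y < p" using dy by linarith
    have "int d * y div int d \<le> p div int d" using dy d by (intro zdiv_mono1) auto
    then show "y \<le> M" using d by (simp add: M_def)
  qed
  have ndp: "\<not> p dvd int d" using dp d by (auto dest: zdvd_imp_le)
  obtain b where b: "[int d * b = 1] (mod p)" using inverse_mod_exists[OF p ndp] by blast
  \<comment> \<open>With \<open>b\<close> the inverse of \<open>d\<close>, the condition
    \<open>(d y)^T = 1\<close> becomes \<open>y^T = b^T\<close>.\<close>
  define \<gamma> where "\<gamma> = b ^ T"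
  have A: "A \<subseteq> pow_res p T \<gamma>"
  proof
    fix y assume y: "y \<in> A"
    have "[(int d * y) ^ T * b ^ T = 1 * b ^ T] (mod p)"
      using y by (intro cong_mult cong_refl) (simp add: A_def)
    moreover have "(int d * y) ^ T * b ^ T = (int d * b) ^ T * y ^ T" by (simp add: power_mult_distrib)
    moreover have "[(int d * b) ^ T * y ^ T = 1 ^ T * y ^ T] (mod p)"
      using b by (intro cong_mult cong_pow cong_refl)
    ultimately have "[y ^ T = \<gamma>] (mod p)" by (simp add: \<gamma>_def cong_def)
    then show "y \<in> pow_res p T \<gamma>" using Apos[OF y] by (simp add: pow_res_def)
  qed
  have dM: "int d * M \<le> p" 
    using mult_div_mod_eq[of "int d" p] pos_mod_sign[of "int d" p] d unfolding M_def by linarith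
  have M0: "0 \<le> M" using p0 d by (simp add: M_def pos_imp_zdiv_nonneg_iff)
  then have "1 * M \<le> int d * M" using d by (intro mult_right_mono) auto
  with M0 dM have M: "0 \<le> M" "M \<le> p" by simp_all
  have Mr: "of_int M \<le> of_int p / real d" unfolding M_def using real_of_int_div4[of p "int d"] by simp
  have "real (card A) \<le> 32 * D * (real t + X)"
  proof -
    consider "u\<^sup>2 \<le> real d" | "u \<le> real d" "real d < u\<^sup>2" | "real d < u" by linarith
    then show ?thesis
    proof cases
      case 1
      \<comment> \<open>Trivial bound: \<open>p / d \<le> u \<le> X\<close> for
        \<open>d \<ge> u^2\<close>.\<close>
      have "card A \<le> card {0<..M}" using Apos by (intro card_mono) auto
      then have "real (card A) \<le> of_int M" using M by simp
      also have "\<dots> \<le> u ^ 3 / real d" using Mr u3 by simp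
      also have "\<dots> \<le> u" using 1 u0 d by (simp add: divide_le_eq power2_eq_square power3_eq_cube)
      also have "\<dots> \<le> X" unfolding X_def using u0 t1 by simp
      also have "\<dots> \<le> 32 * D * (real t + X)"
        using D(1) X0 mult_mono[of 1 "32 * D" X "real t + X"] by simp
      finally show ?thesis .
    next
      case 2
      have "(real (card A))\<^sup>2 \<le> D * (real T * ((of_int M)\<^sup>2 / of_int p + 1))"
        using Apos by (intro card_pairs_power_residue[OF p T M A]) (auto intro: D(2))
      \<comment> \<open>Both terms are at most \<open>u^2 t = X^2\<close>:
        \<open>T M^2 / p \<le> t p / d\<close> uses \<open>d \<ge> u\<close>, and
        \<open>T = t d\<close> uses \<open>d < u^2\<close>.\<close>
      also have "\<dots> \<le> D * (2 * (u\<^sup>2 * real t))"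
      proof (intro mult_left_mono)
        have "real T * ((of_int M)\<^sup>2 / of_int p) \<le> real T * ((of_int p / real d)\<^sup>2 / of_int p)"
          using Mr M p0 by (intro mult_left_mono divide_right_mono power_mono) auto
        also have "\<dots> = real t * (u ^ 3 / real d)"
          using d u0 unfolding u3[symmetric] by (simp add: T_def power2_eq_square power3_eq_cube field_simps)
        also have "\<dots> \<le> real t * u\<^sup>2"
          using 2(1) d u0 by (intro mult_left_mono) (simp_all add: divide_le_eq power2_eq_square power3_eq_cube)
        finally have "real T * ((of_int M)\<^sup>2 / of_int p) \<le> u\<^sup>2 * real t" by (simp add: mult.commute)
        moreover have "real T \<le> u\<^sup>2 * real t"
          using mult_right_mono[of "real d" "u\<^sup>2" "real t"] 2(2) by (simp add: T_def mult.commute)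
        ultimately show "real T * ((of_int M)\<^sup>2 / of_int p + 1) \<le> 2 * (u\<^sup>2 * real t)"
          by (simp add: distrib_left)
      qed (use D(1) in simp)
      also have "\<dots> = 2 * D * X\<^sup>2" by (simp add: X2)
      also have "\<dots> \<le> (2 * D) * (2 * D) * X\<^sup>2"
        using mult_left_mono[of 1 "2 * D" "2 * D"] D(1) by (intro mult_right_mono) auto
      also have "\<dots> = (2 * D * X)\<^sup>2" by (simp add: power2_eq_square)
      finally have sq: "(real (card A))\<^sup>2 \<le> (2 * D * X)\<^sup>2" .
      have "real (card A) \<le> 2 * D * X" by (rule power2_le_imp_le[OF sq]) (use D(1) X0 in simp)
      also have "\<dots> \<le> 32 * D * (real t + X)"
        using D(1) X0 by (intro mult_mono) auto
      finally show ?thesis .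
    next
      case 3
      have "real d ^ 3 < u ^ 3" using 3 by (intro power_strict_mono) auto
      then have "real_of_int (int d ^ 3) < of_int p" by (simp add: u3)
      then have "int d ^ 3 < p" by (simp only: of_int_less_iff)
      then show ?thesis unfolding X_def u_def
        by (rule count_small_divisor[OF p t d _ dM A[unfolded T_def] Apos(2) D])
    qed
  qed
  then show ?thesis using cardA by (simp add: T_def X_def u_def)
qed

section \<open>The sum over residues of given order\<close>

text \<open>Distinct \<open>l\<close> below \<open>p\<close> are incongruent, so their solution sets
  are disjoint, and the order depends only on the residue class.\<close>

lemma sum_J_le_card:
  "(\<Sum>l\<in>{l::nat. 1 \<le> l \<and> l \<le> p - 1 \<and> ord p l = t}. J p (int l))
    \<le> card {x::nat. 1 \<le> x \<and> x \<le> p - 1 \<and> ord p (x ^ x) = t}"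
proof -
  define \<Lambda> where "\<Lambda> = {l::nat. 1 \<le> l \<and> l \<le> p - 1 \<and> ord p l = t}"
  define S where "S l = {x::nat. 1 \<le> x \<and> x \<le> p - 1 \<and> [x ^ x = l] (mod p)}" for l
  have J: "J p (int l) = card (S l)" for l
    unfolding J_def S_def by (simp flip: cong_int_iff)
  have finS: "finite (S l)" for l
    unfolding S_def by (rule finite_subset[of _ "{..p - 1}"]) auto
  have fin\<Lambda>: "finite \<Lambda>"
    unfolding \<Lambda>_def by (rule finite_subset[of _ "{..p - 1}"]) auto
  have "(\<Sum>l\<in>\<Lambda>. J p (int l)) = card (\<Union>l\<in>\<Lambda>. S l)"
    unfolding J
  proof (subst card_UN_disjoint)
    show "\<forall>l\<in>\<Lambda>. \<forall>l'\<in>\<Lambda>. l \<noteq> l' \<longrightarrow> S l \<inter> S l' = {}"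
    proof (intro ballI impI equals0I)
      fix l l' x assume l: "l \<in> \<Lambda>" "l' \<in> \<Lambda>" "l \<noteq> l'" "x \<in> S l \<inter> S l'"
      then have "[l = l'] (mod p)" unfolding S_def by (auto intro: cong_trans cong_sym)
      moreover have "l < p" "l' < p" using l by (auto simp: \<Lambda>_def)
      ultimately show False using l(3) by (simp add: cong_less_modulus_unique_nat)
    qed
  qed (simp_all add: fin\<Lambda> finS)
  also have "\<dots> \<le> card {x::nat. 1 \<le> x \<and> x \<le> p - 1 \<and> ord p (x ^ x) = t}"
  proof (rule card_mono)
    show "finite {x::nat. 1 \<le> x \<and> x \<le> p - 1 \<and> ord p (x ^ x) = t}"
      by (rule finite_subset[of _ "{..p - 1}"]) auto
    show "(\<Union>l\<in>\<Lambda>. S l) \<subseteq> {x. 1 \<le> x \<and> x \<le> p - 1 \<and> ord p (x ^ x) = t}"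
      by (auto simp: S_def \<Lambda>_def dest: ord_cong)
  qed
  finally show ?thesis by (simp add: \<Lambda>_def)
qed

text \<open>The order of \<open>x^x\<close> is \<open>ord p x / gcd x (ord p x)\<close>. With
  \<open>d\<close> this gcd, \<open>t d\<close> is the order of \<open>x\<close> itself, hence
  divides \<open>p - 1\<close>.\<close>

lemma ord_self_power_decomp:
  assumes p: "prime p" and t: "t > 0" and x: "1 \<le> x" "x \<le> p - 1" and ordx: "ord p (x ^ x) = t"
  shows "\<exists>d. d dvd p - 1 \<and> t * d < p \<and> d > 0 \<and> d dvd x \<and> [x ^ (t * d) = 1] (mod p)"
proof -
  have p1: "p > 1" using p by (rule prime_gt_1_nat)
  have "\<not> p dvd x" using x p1 by (auto dest: dvd_imp_le)
  then have cop: "coprime p x" using p by (simp add: prime_imp_coprime)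
  define d where "d = gcd x (ord p x)"
  have "t * d = ord p x" using ord_power_aux[of p x x] ordx by (simp add: d_def)
  moreover have "ord p x dvd p - 1"
    using order_divides_totient[OF cop] p by (simp add: totient_prime)
  moreover have "d dvd p - 1" using \<open>ord p x dvd p - 1\<close> by (auto simp: d_def intro: dvd_trans)
  moreover have "ord p x \<le> p - 1" using \<open>ord p x dvd p - 1\<close> p1 by (intro dvd_imp_le) auto
  moreover have "d > 0" using x by (simp add: d_def)
  moreover have "d dvd x" by (simp add: d_def)
  ultimately show ?thesis using p1 by (intro exI[of _ d]) (auto simp: ord_divides')
qed

theorem theorem2:
  shows "\<forall>\<epsilon>::real. \<epsilon> > 0 \<longrightarrow> (\<exists>c::real. c > 0 \<and>
    (\<forall>p t :: nat. prime p \<longrightarrow> t > 0 \<longrightarrow> t dvd p - 1 \<longrightarrow>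
      real (\<Sum>l \<in> {l::nat. 1 \<le> l \<and> l \<le> p - 1 \<and> ord p l = t}. J p (int l))
        < c * (real t + real p powr (1/3) * real t powr (1/2)) * real p powr \<epsilon>))"
proof (intro allI impI)
  fix \<epsilon> :: real
  assume \<epsilon>: "\<epsilon> > 0"
  \<comment> \<open>The exponent is split in three: the number of \<open>d\<close> costs
    \<open>p^(\<epsilon>/3)\<close>, and the factor \<open>D\<close>, which bounds divisors of
    integers up to \<open>p^2\<close>, costs \<open>p^(2\<epsilon>/3)\<close>.\<close>
  obtain C where C: "C \<ge> 1" "\<And>n. n > 0 \<Longrightarrow> real (card {d::nat. d dvd n}) \<le> C * real n powr (\<epsilon>/3)"
    using card_divisors_le_powr[of "\<epsilon>/3"] \<epsilon> by auto
  \<comment> \<open>The constant 32 of \<open>count_divisor\<close>, raised by one for the strict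
    inequality.\<close>
  define c where "c = 33 * C\<^sup>2"
  have "real (\<Sum>l \<in> {l::nat. 1 \<le> l \<and> l \<le> p - 1 \<and> ord p l = t}. J p (int l))
      < c * (real t + real p powr (1/3) * real t powr (1/2)) * real p powr \<epsilon>"
    if p: "prime p" and t: "t > 0" for p t :: nat
  proof -
    define X where "X = real t + real p powr (1/3) * real t powr (1/2)"
    define \<D> where "\<D> = {d. d dvd p - 1 \<and> t * d < p \<and> d > 0}"
    define N where "N d = {x \<in> {0<..<int p}. int d dvd x \<and> [x ^ (t * d) = 1] (mod int p)}" for d
    define D where "D = C * real p powr (2 * \<epsilon> / 3)"
    have p1: "p > 1" using p by (rule prime_gt_1_nat)
    have X0: "X > 0" using t by (simp add: X_def add_pos_nonneg)
    have "real p powr (2 * \<epsilon> / 3) \<ge> 1" using p1 \<epsilon> by (intro ge_one_powr_ge_zero) auto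
    then have D1: "D \<ge> 1" using C(1) mult_mono[of 1 C 1 "real p powr (2 * \<epsilon> / 3)"] by (simp add: D_def)
    have div: "real (card {a::int. 0 < a \<and> a dvd n}) \<le> D" if n: "0 < n" "n \<le> (int p)\<^sup>2" for n
    proof -
      have "real (card {a::int. 0 < a \<and> a dvd n}) \<le> C * real (nat n) powr (\<epsilon>/3)"
        using C(2)[of "nat n"] n by (simp add: card_int_divisors)
      also have "real_of_int n \<le> real_of_int ((int p)\<^sup>2)" using n(2) by (simp only: of_int_le_iff)
      then have "real (nat n) \<le> (real p)\<^sup>2" using n(1) by simp
      then have "C * real (nat n) powr (\<epsilon>/3) \<le> C * ((real p)\<^sup>2) powr (\<epsilon>/3)"
        using C(1) \<epsilon> by (intro mult_left_mono powr_mono2) auto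
      also have "\<dots> = D" using p1 by (simp add: D_def powr_powr flip: powr_numeral)
      finally show ?thesis .
    qed
    have fin: "finite {d. d dvd p - 1}" using p1 by simp
    have "card {x::nat. 1 \<le> x \<and> x \<le> p - 1 \<and> ord p (x ^ x) = t} \<le> card (\<Union>d\<in>\<D>. N d)"
    proof (rule card_inj_on_le[of int])
      show "int ` {x::nat. 1 \<le> x \<and> x \<le> p - 1 \<and> ord p (x ^ x) = t} \<subseteq> (\<Union>d\<in>\<D>. N d)"
      proof (rule image_subsetI)
        fix x assume x: "x \<in> {x::nat. 1 \<le> x \<and> x \<le> p - 1 \<and> ord p (x ^ x) = t}"
        then obtain d where d: "d dvd p - 1" "t * d < p" "d > 0" "d dvd x" "[x ^ (t * d) = 1] (mod p)"
          using ord_self_power_decomp[OF p t] by blast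
        have "[int (x ^ (t * d)) = int 1] (mod int p)" using d(5) by (simp only: cong_int_iff)
        then have "int x \<in> N d" using x p1 d(4) by (auto simp: N_def)
        then show "int x \<in> (\<Union>d\<in>\<D>. N d)" using d by (auto simp: \<D>_def)
      qed
      show "finite (\<Union>d\<in>\<D>. N d)"
      proof (rule finite_UN_I)
        show "finite (N d)" for d by (rule finite_subset[of _ "{0<..<int p}"]) (auto simp: N_def)
      qed (use fin in \<open>simp add: \<D>_def\<close>)
    qed simp
    also have "\<dots> \<le> (\<Sum>d\<in>\<D>. card (N d))"
      using fin by (intro card_UN_le) (auto simp: \<D>_def)
    finally have "real (\<Sum>l \<in> {l::nat. 1 \<le> l \<and> l \<le> p - 1 \<and> ord p l = t}. J p (int l))
        \<le> (\<Sum>d\<in>\<D>. real (card (N d)))"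
      using order_trans[OF sum_J_le_card[of p t]] by (simp flip: of_nat_sum)
    also have "\<dots> \<le> (\<Sum>d\<in>\<D>. 32 * D * X)"
    proof (rule sum_mono)
      fix d assume "d \<in> \<D>"
      then have d: "d > 0" "int (t * d) < int p" by (auto simp: \<D>_def simp del: of_nat_mult)
      have "prime (int p)" using p by simp
      from count_divisor[OF this t d D1 div]
      show "real (card (N d)) \<le> 32 * D * X" by (simp add: N_def X_def)
    qed
    also have "\<dots> = real (card \<D>) * (32 * D * X)" by simp
    also have "\<dots> \<le> (C * real p powr (\<epsilon>/3)) * (32 * D * X)"
    proof (rule mult_right_mono)
      have "card \<D> \<le> card {d. d dvd p - 1}" using fin by (intro card_mono) (auto simp: \<D>_def)
      then have "real (card \<D>) \<le> C * real (p - 1) powr (\<epsilon>/3)"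
        using C(2)[of "p - 1"] p1 by linarith
      also have "\<dots> \<le> C * real p powr (\<epsilon>/3)"
        using C(1) \<epsilon> by (intro mult_left_mono powr_mono2) auto
      finally show "real (card \<D>) \<le> C * real p powr (\<epsilon>/3)" .
    qed (use D1 X0 in auto)
    also have "\<dots> = 32 * C\<^sup>2 * X * (real p powr (\<epsilon>/3) * real p powr (2 * \<epsilon> / 3))"
      by (simp add: D_def power2_eq_square)
    also have "real p powr (\<epsilon>/3) * real p powr (2 * \<epsilon> / 3) = real p powr \<epsilon>"
      by (simp flip: powr_add)
    also have "32 * C\<^sup>2 * X * real p powr \<epsilon> < c * X * real p powr \<epsilon>"
      unfolding c_def using C(1) X0 p1 by (intro mult_strict_right_mono) auto
    finally show ?thesis by (simp add: X_def)
  qed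
  then show "\<exists>c>0. \<forall>p t :: nat. prime p \<longrightarrow> t > 0 \<longrightarrow> t dvd p - 1 \<longrightarrow>
      real (\<Sum>l \<in> {l::nat. 1 \<le> l \<and> l \<le> p - 1 \<and> ord p l = t}. J p (int l))
        < c * (real t + real p powr (1/3) * real t powr (1/2)) * real p powr \<epsilon>"
    using C(1) by (intro exI[of _ c] conjI allI impI) (simp_all add: c_def)
qed

end
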